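(* Let $f^-,f^+,g^-,g^+:\mathbb{R}^2\to\mathbb{R}$ be functions of class $C^4$, and write $0=(0,0)$. Assume that the origin is an asymptotically stable switched equilibrium of the Filippov system $(\dot x,\dot y)=(f^-,g^-)(x,y)$ for $x<0$, $(\dot x,\dot y)=(f^+,g^+)(x,y)$ for $x>0$, in the sense that the following three conditions hold: $$f^-(0)>0,\qquad f^+(0)<0,$$ $$f^+(0)\,g^-(0)-f^-(0)\,g^+(0)=0,$$ $$\frac{\partial f^+}{\partial y}(0)\,g^-(0)+f^+(0)\,\frac{\partial g^-}{\partial y}(0)-\frac{\partial f^-}{\partial y}(0)\,g^+(0)-f^-(0)\,\frac{\partial g^+}{\partial y}(0)>0.$$ Then, for all $\bar x>0$ sufficiently small, the switched system with hysteresis $$\dot x(t)=f^k(x(t),y(t)),\quad \dot y(t)=g^k(x(t),y(t)),\qquad k:=+1\ \text{ if } x(t)>\bar x,\quad k:=-1\ \text{ if } x(t)<-\bar x,$$ possesses an orbitally stable limit cycle, which shrinks to the origin as $\bar x\to 0^+$. The period $T(\bar x)$ of this cycle satisfies $$T(\bar x)=\left(-\frac{2}{f^+(0)}+\frac{2}{f^-(0)}\right)\bar x+O(\bar x^2)\qquad\text{as }\bar x\to0^+.$$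
   Context: Notation: for $k=+1$, $(f^k,g^k)=(f^+,g^+)$; for $k=-1$, $(f^k,g^k)=(f^-,g^-)$. Switched system, for a parameter $\bar x>0$: a state is a triple $(x,y,k)$ with $(x,y)\in\mathbb{R}^2$ and $k\in\{-1,+1\}$, where $k=+1$ if $x\ge\bar x$, $k=-1$ if $x\le-\bar x$, and $k$ may be either value if $-\bar x<x<\bar x$. A trajectory is determined by an initial point $(x(0),y(0))$ and an initial index $k$. It follows the system $\dot x=f^k(x,y)$, $\dot y=g^k(x,y)$ until it reaches one of the lines $\{-\bar x\}\times\mathbb{R}$ or $\{\bar x\}\times\mathbb{R}$; at that moment $k$ is set to $-1$ if the line $\{-\bar x\}\times\mathbb{R}$ is hit, and to $+1$ if the line $\{\bar x\}\times\mathbb{R}$ is hit, regardless of the side from which the line is hit (so $k$ may remain unchanged). The trajectory then continues along the system with the new $k$ until it again reaches one of the two lines, where the same rule applies, and so on; $(x(t),y(t))$ is continuous in $t$. Only forward trajectories that intersect the switching lines transversally are considered. A limit cycle is an isolated nonconstant periodic trajectory $t\mapsto(x(t),y(t),k(t))$ of the switched system, and its period is its minimal period. Orbitally stable means stable and attracting as an orbit: trajectories whose initial states (with their index $k$) are sufficiently close to the cycle remain close to it for all $t\ge 0$ and their distance to the cycle tends to $0$ as $t\to\infty$. "Shrinks to the origin as $\bar x\to0^+$" means that the maximal distance from the points $(x(t),y(t))$ of the cycle to $(0,0)$ tends to $0$ as $\bar x\to 0^+$. Meaning of the hypotheses: the first condition makes the line $x=0$ a sliding region of the Filippov system near the origin,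 where the sliding equation is $$\dot y=\frac{f^+(0,y)g^-(0,y)-f^-(0,y)g^+(0,y)}{f^+(0,y)-f^-(0,y)}.$$ The second condition says that $y=0$ is an equilibrium of this equation, and the third says that the derivative of its right-hand side at $y=0$ is negative. *)

theory Defs
  imports "HOL-Analysis.Analysis" "HOL-Library.Landau_Symbols"
begin

(* Class C^n on the plane.  In the successor case f1 and f2 are the two partial
   derivatives of f. *)
primrec class_C :: "nat \<Rightarrow> (real \<times> real \<Rightarrow> real) \<Rightarrow> bool" where
  "class_C 0 f \<longleftrightarrow> continuous_on UNIV f"
| "class_C (Suc n) f \<longleftrightarrow>
     (\<exists>f1 f2. (\<forall>p. (f has_derivative (\<lambda>h. f1 p * fst h + f2 p * snd h)) (at p))
        \<and> class_C n f1 \<and> class_C n f2)"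

definition partial_y :: "(real \<times> real \<Rightarrow> real) \<Rightarrow> real \<times> real \<Rightarrow> real" where
  "partial_y f p = deriv (\<lambda>y. f (fst p, y)) (snd p)"

(* A state ((x, y), k). *)
type_synonym state = "(real \<times> real) \<times> int"

definition field_of ::
  "(real \<times> real \<Rightarrow> real) \<Rightarrow> (real \<times> real \<Rightarrow> real) \<Rightarrow> (real \<times> real \<Rightarrow> real) \<Rightarrow>
   (real \<times> real \<Rightarrow> real) \<Rightarrow> int \<Rightarrow> real \<times> real \<Rightarrow> real \<times> real" where
  "field_of fm fp gm gp k p = (if k = 1 then (fp p, gp p) else (fm p, gm p))"

definition valid_state :: "real \<Rightarrow> state \<Rightarrow> bool" where
  "valid_state xb s \<longleftrightarrow> snd s \<in> {-1, 1}
     \<and> (fst (fst s) \<ge> xb \<longrightarrow> snd s = 1)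
     \<and> (fst (fst s) \<le> -xb \<longrightarrow> snd s = -1)"

definition on_line :: "real \<Rightarrow> state \<Rightarrow> bool" where
  "on_line xb s \<longleftrightarrow> fst (fst s) = xb \<or> fst (fst s) = -xb"

(* Forward trajectories, defined for all t >= 0; the values of z at negative times are
   irrelevant.  At a hitting time the index already has its new value (k is right-continuous):
   this value is the one prescribed by valid_state.  Between hitting times k is constant and the
   corresponding system is followed; together with continuity of the position this also
   determines the motion up to the end points of such an interval.  The finiteness condition
   says that the hitting times form a (finite or infinite) sequence without accumulation.
   Transversality: at a hit, the field with the new index is not vertical, and for t > 0 neither
   is the field with the index j that was active just before t. *)
definition trajectory ::
  "(int \<Rightarrow> real \<times> real \<Rightarrow> real \<times> real) \<Rightarrow> real \<Rightarrow> (real \<Rightarrow> state) \<Rightarrow> bool" where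
  "trajectory F xb z \<longleftrightarrow>
     continuous_on {0..} (\<lambda>t. fst (z t))
     \<and> (\<forall>t\<ge>0. valid_state xb (z t))
     \<and> (\<forall>\<tau>. finite {t\<in>{0..\<tau>}. on_line xb (z t)})
     \<and> (\<forall>s t. 0 \<le> s \<and> s < t \<and> (\<forall>u\<in>{s<..<t}. \<not> on_line xb (z u)) \<longrightarrow>
          (\<forall>u\<in>{s<..<t}. snd (z u) = snd (z s)
             \<and> ((\<lambda>v. fst (z v)) has_vector_derivative F (snd (z s)) (fst (z u))) (at u)))
     \<and> (\<forall>t\<ge>0. on_line xb (z t) \<longrightarrow> fst (F (snd (z t)) (fst (z t))) \<noteq> 0)
     \<and> (\<forall>t>0. on_line xb (z t) \<longrightarrow>
          (\<exists>j. (\<forall>\<^sub>F s in at_left t. snd (z s) = j) \<and> fst (F j (fst (z t))) \<noteq> 0))"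

(* Distance from a state to a nonempty set of states.  There is no metric on int, so the index
   is embedded into the reals; states with distinct indices have distance at least 2, so states
   that are close to each other have the same index. *)
definition embed_state :: "state \<Rightarrow> (real \<times> real) \<times> real" where
  "embed_state s = (fst s, of_int (snd s))"

definition state_dist :: "state \<Rightarrow> state set \<Rightarrow> real" where
  "state_dist s C = infdist (embed_state s) (embed_state ` C)"

definition orbit :: "(real \<Rightarrow> state) \<Rightarrow> state set" where
  "orbit z = z ` {0..}"

definition has_period :: "(real \<Rightarrow> state) \<Rightarrow> real \<Rightarrow> bool" where
  "has_period z T \<longleftrightarrow> T > 0 \<and> (\<forall>t\<ge>0. z (t + T) = z t)"

definition minimal_period :: "(real \<Rightarrow> state) \<Rightarrow> real \<Rightarrow> bool" where
  "minimal_period z T \<longleftrightarrow> has_period z T \<and> (\<forall>S. has_period z S \<longrightarrow> T \<le> S)"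

(* A periodic trajectory is isolated if every periodic trajectory with some state
   close to its orbit has the same orbit. *)
definition limit_cycle ::
  "(int \<Rightarrow> real \<times> real \<Rightarrow> real \<times> real) \<Rightarrow> real \<Rightarrow> (real \<Rightarrow> state) \<Rightarrow> bool" where
  "limit_cycle F xb z \<longleftrightarrow>
     trajectory F xb z
     \<and> (\<exists>T. has_period z T)
     \<and> \<not> (\<forall>t\<ge>0. z t = z 0)
     \<and> (\<exists>\<epsilon>>0. \<forall>w. trajectory F xb w \<and> (\<exists>T. has_period w T)
           \<and> (\<exists>s\<in>orbit w. state_dist s (orbit z) < \<epsilon>) \<longrightarrow> orbit w = orbit z)"

(* The trajectories considered are defined on the whole half line, so the first conjunct is
   needed to exclude nearby initial states whose motion does not exist for all times. *)
definition orbitally_stable ::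
  "(int \<Rightarrow> real \<times> real \<Rightarrow> real \<times> real) \<Rightarrow> real \<Rightarrow> state set \<Rightarrow> bool" where
  "orbitally_stable F xb C \<longleftrightarrow>
     (\<exists>\<delta>>0. \<forall>s. valid_state xb s \<and> state_dist s C < \<delta> \<longrightarrow> (\<exists>w. trajectory F xb w \<and> w 0 = s))
     \<and> (\<forall>\<epsilon>>0. \<exists>\<delta>>0. \<forall>w. trajectory F xb w \<and> state_dist (w 0) C < \<delta> \<longrightarrow>
          (\<forall>t\<ge>0. state_dist (w t) C < \<epsilon>))
     \<and> (\<exists>\<delta>>0. \<forall>w. trajectory F xb w \<and> state_dist (w 0) C < \<delta> \<longrightarrow>
          ((\<lambda>t. state_dist (w t) C) \<longlongrightarrow> 0) at_top)"

definition max_dist_origin :: "(real \<Rightarrow> state) \<Rightarrow> real" where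
  "max_dist_origin z = (SUP s\<in>orbit z. norm (fst s))"

end

theory Submission
  imports Defs
begin

text \<open>
  In the coordinate \<open>s = xb - k * x\<close> a trajectory of index \<open>k\<close> near the origin is a graph over
  \<open>[0, 2 * xb]\<close>, a solution of the scalar equation \<open>dy/ds = h k\<close> with
  \<open>h k = g\<^sup>k / (- k * f\<^sup>k)\<close>.  The two slopes cancel at the origin, so the return map moves
  \<open>0\<close> by \<open>O(xb\<^sup>2)\<close> only.  If \<open>\<alpha> k\<close> bounds the \<open>y\<close>-derivative of \<open>h k\<close>
  near the origin from above, Gronwall's inequality shows that the half map of index \<open>k\<close> multiplies
  distances by at most \<open>exp (2 * xb * \<alpha> k)\<close>; the third hypothesis says precisely that
  \<open>\<alpha> 1 + \<alpha> (-1) < 0\<close> is possible.  Hence the return map is a contraction of an interval of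
  radius \<open>O(xb)\<close>.  Its fixed point gives the cycle, the contraction gives stability, and isolation
  follows because a periodic trajectory that is attracted by the cycle lies on it.
\<close>

section \<open>Scalar differential equations\<close>

text \<open>The obstacle is that the contraction degenerates as \<open>xb\<close> tends to
  \<open>0\<close>: one round trip contracts only by a factor \<open>1 - O(xb)\<close>. It is the
  ratio of the displacement \<open>O(xb\<^sup>2)\<close> to this defect \<open>O(xb)\<close> that
  keeps the fixed point within \<open>O(xb)\<close>; the constant \<open>M1\<close> is this ratio.
  Moreover one of the half maps may expand, so Lipschitz constants are too coarse and the signed
  constants \<open>\<alpha> k\<close> are needed. The second hypothesis gives both fields the same
  direction at the origin. Because of this, the sum of the \<open>y\<close>-derivatives of the two
  slopes there, multiplied by the negative number \<open>fp (0, 0) * fm (0, 0)\<close>, is the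
  left-hand side of the third. Eliminating time replaces the planar flow by two scalar equations,
  one for the graph and one for the time along it. To make them solvable globally, their
  coefficients are extended from a box to the plane; the curves built from them are then shown to
  stay in the box, so they are trajectories of the original fields. Uniqueness for the original
  fields transfers the estimates to every trajectory that starts near the cycle.\<close>

lemma one_sided_gronwall:
  fixes D D' :: "real \<Rightarrow> real"
  assumes ab: "a \<le> b"
    and der: "\<And>s. a \<le> s \<Longrightarrow> s \<le> b \<Longrightarrow> (D has_real_derivative D' s) (at s)"
    and le: "\<And>s. a \<le> s \<Longrightarrow> s \<le> b \<Longrightarrow> D s * D' s \<le> \<alpha> * (D s)\<^sup>2"
  shows "\<bar>D b\<bar> \<le> exp (\<alpha> * (b - a)) * \<bar>D a\<bar>"
proof -
  define g where "g s = (D s)\<^sup>2 * exp (- (2 * \<alpha> * s))" for s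
  have "g b \<le> g a"
  proof (rule DERIV_nonpos_imp_nonincreasing[OF ab])
    fix s assume s: "a \<le> s" "s \<le> b"
    \<comment> \<open>Only an upper bound on \<open>D * D'\<close> enters, so
      \<open>\<alpha>\<close> may be negative; this is the source of genuine contraction.\<close>
    have "(g has_real_derivative
        2 * (D s * D' s - \<alpha> * (D s)\<^sup>2) * exp (- (2 * \<alpha> * s))) (at s)"
      unfolding g_def
      by (auto intro!: derivative_eq_intros der s simp: algebra_simps power2_eq_square)
    moreover have "2 * (D s * D' s - \<alpha> * (D s)\<^sup>2) * exp (- (2 * \<alpha> * s)) \<le> 0"
      using le[OF s] by (simp add: mult_nonpos_nonneg)
    ultimately show "\<exists>y. (g has_real_derivative y) (at s) \<and> y \<le> 0" by blast
  qed
  then have "(D b)\<^sup>2 * exp (- (2 * \<alpha> * b)) * exp (2 * \<alpha> * b)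
      \<le> (D a)\<^sup>2 * exp (- (2 * \<alpha> * a)) * exp (2 * \<alpha> * b)"
    unfolding g_def by (rule mult_right_mono) simp
  then have "(D b)\<^sup>2 \<le> (D a)\<^sup>2 * exp (2 * \<alpha> * (b - a))"
    by (simp add: mult.assoc exp_add[symmetric] algebra_simps)
  also have "\<dots> = (exp (\<alpha> * (b - a)) * \<bar>D a\<bar>)\<^sup>2"
    by (simp add: power_mult_distrib exp_double[symmetric] mult.assoc mult.commute)
  finally show ?thesis
    by (metis abs_ge_zero abs_le_square_iff abs_mult abs_exp_cancel abs_abs)
qed

text \<open>Comparison with an antiderivative of the bound on \<open>D'\<close>. The division by
  \<open>\<kappa>\<close> is the gain that makes the weighted integral operator contracting;
  negative times follow by reflection.\<close>

lemma exp_growth_bound: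
  fixes D D' :: "real \<Rightarrow> real"
  assumes der: "\<And>t. (D has_real_derivative D' t) (at t)" and D0: "D 0 = 0"
    and le: "\<And>t. \<bar>D' t\<bar> \<le> K * exp (\<kappa> * \<bar>t\<bar>)" and l: "\<kappa> > 0" and K: "K \<ge> 0"
  shows "\<bar>D t\<bar> \<le> K / \<kappa> * exp (\<kappa> * \<bar>t\<bar>)"
proof -
  have *: "E t \<le> K / \<kappa> * exp (\<kappa> * t)"
    if "\<And>t. (E has_real_derivative E' t) (at t)" "E 0 = 0"
      "\<And>t. \<bar>E' t\<bar> \<le> K * exp (\<kappa> * \<bar>t\<bar>)" "t \<ge> 0"
    for E E' and t :: real
  proof -
    have "E t - K / \<kappa> * exp (\<kappa> * t) \<le> E 0 - K / \<kappa> * exp (\<kappa> * 0)"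
    proof (rule DERIV_nonpos_imp_nonincreasing[OF \<open>t \<ge> 0\<close>])
      fix s :: real assume s: "0 \<le> s" "s \<le> t"
      have "((\<lambda>t. E t - K / \<kappa> * exp (\<kappa> * t)) has_real_derivative E' s - K * exp (\<kappa> * s)) (at s)"
        using l by (auto intro!: derivative_eq_intros that)
      moreover have "E' s - K * exp (\<kappa> * s) \<le> 0" using that(3)[of s] s by simp
      ultimately show "\<exists>y. ((\<lambda>t. E t - K / \<kappa> * exp (\<kappa> * t)) has_real_derivative y) (at s) \<and> y \<le> 0"
        by blast
    qed
    moreover have "K / \<kappa> \<ge> 0" using K l by simp
    ultimately show ?thesis using that(2) by simp
  qed
  have r: "((\<lambda>t. D (- t)) has_real_derivative - D' (- t)) (at t)" for t
    using DERIV_mirror[of D "D' (- t)" t] der[of "- t"] by simp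
  show ?thesis
  proof (cases "t \<ge> 0")
    case True
    have "D t \<le> K / \<kappa> * exp (\<kappa> * t)" by (rule *[of D D']) (use der D0 le True in auto)
    moreover have "- D t \<le> K / \<kappa> * exp (\<kappa> * t)"
      by (rule *[of "\<lambda>t. - D t" "\<lambda>t. - D' t"])
        (use der D0 le True in \<open>auto intro!: derivative_eq_intros\<close>)
    ultimately show ?thesis using True by (simp add: abs_le_iff)
  next
    case False
    have "D (- (- t)) \<le> K / \<kappa> * exp (\<kappa> * (- t))"
      by (rule *[of "\<lambda>t. D (- t)" "\<lambda>t. - D' (- t)"])
       (use r D0 le[of "- _"] False in auto)
    moreover have "- D (- (- t)) \<le> K / \<kappa> * exp (\<kappa> * (- t))"
      by (rule *[of "\<lambda>t. - D (- t)" "\<lambda>t. D' (- t)"])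
       (use DERIV_minus[OF r] D0 le[of "- _"] False in auto)
    ultimately show ?thesis using False by (simp add: abs_le_iff)
  qed
qed

lemma continuous_antiderivative:
  fixes g :: "real \<Rightarrow> real"
  assumes "continuous_on UNIV g"
  shows "\<exists>G. G 0 = 0 \<and> (\<forall>t. (G has_real_derivative g t) (at t))"
proof -
  have "\<exists>F. \<forall>x :: real. (-\<infinity> :: ereal) < x \<longrightarrow> x < (\<infinity> :: ereal) \<longrightarrow> (F has_vector_derivative g x) (at x)"
    by (rule einterval_antiderivative)
      (use assms in \<open>auto simp: continuous_on_eq_continuous_at\<close>)
  then obtain F where "\<And>x. (F has_real_derivative g x) (at x)"
    by (auto simp: has_real_derivative_iff_has_vector_derivative)
  then show ?thesis
    by (intro exI[of _ "\<lambda>t. F t - F 0"]) (auto intro!: derivative_eq_intros)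
qed

text \<open>Banach's theorem in the space of bounded continuous functions, where \<open>u\<close> stands for the
  solution divided by \<open>exp (\<kappa> * \<bar>t\<bar>)\<close>; this weight makes the integral operator a contraction
  on the whole line.\<close>

lemma picard_lindelof_0:
  fixes f :: "real \<Rightarrow> real \<Rightarrow> real"
  assumes lip: "\<And>t x y. \<bar>f t x - f t y\<bar> \<le> L * \<bar>x - y\<bar>"
    and cont: "continuous_on UNIV (\<lambda>p. f (fst p) (snd p))"
    and bd: "\<And>t x. \<bar>f t x\<bar> \<le> M" and L: "L > 0"
  shows "\<exists>Y. Y 0 = y0 \<and> (\<forall>t. (Y has_real_derivative f t (Y t)) (at t))"
proof -
  \<comment> \<open>Integration against the weight leaves the factor \<open>L / \<kappa>\<close>,
    which this choice makes \<open>1/2\<close>.\<close>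
  define \<kappa> where "\<kappa> = 2 * L"
  have l: "\<kappa> > 0" using L by (simp add: \<kappa>_def)
  have M: "M \<ge> 0" using bd[of 0 0] by simp
  define w where "w u t = exp (\<kappa> * \<bar>t\<bar>) * apply_bcontfun u t" for u :: "real \<Rightarrow>\<^sub>C real" and t
  have cw: "continuous_on UNIV (w u)" for u
    unfolding w_def by (intro continuous_intros continuous_on_apply_bcontfun)
  have "\<exists>G. G 0 = 0 \<and> (\<forall>t. (G has_real_derivative f t (w u t)) (at t))" for u
  proof (rule continuous_antiderivative)
    show "continuous_on UNIV (\<lambda>t. f t (w u t))"
      using continuous_on_compose2[OF cont continuous_on_Pair[OF continuous_on_id cw]] by auto
  qed
  then obtain G where G0: "\<And>u. G u 0 = 0"
    and G: "\<And>u t. (G u has_real_derivative f t (w u t)) (at t)"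
    by metis
  \<comment> \<open>Picard's integral operator divided by the weight, so that its values are again
    bounded functions.\<close>
  define \<Phi> where "\<Phi> u t = exp (- (\<kappa> * \<bar>t\<bar>)) * (y0 + G u t)" for u t
  have bc: "\<Phi> u \<in> bcontfun" for u
  proof (rule bcontfun_normI)
    have "continuous_on UNIV (G u)"
      by (auto simp: continuous_on_eq_continuous_at intro: DERIV_isCont[OF G])
    then show "continuous_on UNIV (\<Phi> u)" unfolding \<Phi>_def by (intro continuous_intros)
    fix t
    have "M * 1 \<le> M * exp (\<kappa> * \<bar>t\<bar>)" for t
      by (rule mult_left_mono) (use l M in auto)
    then have "\<bar>f t (w u t)\<bar> \<le> M * exp (\<kappa> * \<bar>t\<bar>)" for t
      using bd[of t "w u t"] by (smt (verit) mult.right_neutral)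
    then have "\<bar>G u t\<bar> \<le> M / \<kappa> * exp (\<kappa> * \<bar>t\<bar>)"
      by (rule exp_growth_bound[of "G u", OF G G0 _ l M])
    then have "\<bar>y0 + G u t\<bar> \<le> \<bar>y0\<bar> * exp (\<kappa> * \<bar>t\<bar>) + M / \<kappa> * exp (\<kappa> * \<bar>t\<bar>)"
      using mult_left_mono[of 1 "exp (\<kappa> * \<bar>t\<bar>)" "\<bar>y0\<bar>"] l by simp
    then have "\<bar>y0 + G u t\<bar> \<le> (\<bar>y0\<bar> + M / \<kappa>) * exp (\<kappa> * \<bar>t\<bar>)"
      by (simp add: algebra_simps)
    then have "exp (- (\<kappa> * \<bar>t\<bar>)) * \<bar>y0 + G u t\<bar>
       \<le> exp (- (\<kappa> * \<bar>t\<bar>)) * ((\<bar>y0\<bar> + M / \<kappa>) * exp (\<kappa> * \<bar>t\<bar>))"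
      by (rule mult_left_mono) simp
    also have "\<dots> = \<bar>y0\<bar> + M / \<kappa>" by (simp add: exp_minus field_simps)
    finally show "norm (\<Phi> u t) \<le> \<bar>y0\<bar> + M / \<kappa>" by (simp add: \<Phi>_def abs_mult)
  qed
  define \<Psi> where "\<Psi> u = Bcontfun (\<Phi> u)" for u
  have \<Psi>: "apply_bcontfun (\<Psi> u) t = \<Phi> u t" for u t
    by (simp add: \<Psi>_def Bcontfun_inverse bc)
  have "\<exists>!u. \<Psi> u = u"
  proof (rule banach_fix_type[of "1/2"])
    show "\<forall>u v. dist (\<Psi> u) (\<Psi> v) \<le> 1/2 * dist u v"
    proof (intro allI dist_bound)
      fix u v :: "real \<Rightarrow>\<^sub>C real" and t
      have "\<bar>f t (w u t) - f t (w v t)\<bar> \<le> L * dist u v * exp (\<kappa> * \<bar>t\<bar>)" for t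
      proof -
        have "\<bar>f t (w u t) - f t (w v t)\<bar> \<le> L * \<bar>w u t - w v t\<bar>" by (rule lip)
        also have "\<bar>w u t - w v t\<bar> = exp (\<kappa> * \<bar>t\<bar>) * dist (u t) (v t)"
          by (simp add: w_def dist_real_def right_diff_distrib[symmetric] abs_mult)
        also have "\<dots> \<le> exp (\<kappa> * \<bar>t\<bar>) * dist u v"
          by (intro mult_left_mono dist_bounded) simp
        finally show ?thesis using L by (simp add: mult_ac)
      qed
      then have "\<bar>G u t - G v t\<bar> \<le> L * dist u v / \<kappa> * exp (\<kappa> * \<bar>t\<bar>)"
        using L l G G0
        by (intro exp_growth_bound[of "\<lambda>t. G u t - G v t" "\<lambda>t. f t (w u t) - f t (w v t)"])
          (auto intro!: derivative_eq_intros)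
      then have "exp (- (\<kappa> * \<bar>t\<bar>)) * \<bar>G u t - G v t\<bar>
         \<le> exp (- (\<kappa> * \<bar>t\<bar>)) * (L * dist u v / \<kappa> * exp (\<kappa> * \<bar>t\<bar>))"
        by (rule mult_left_mono) simp
      also have "\<dots> = 1/2 * dist u v" using L by (simp add: exp_minus field_simps \<kappa>_def)
      finally show "dist (\<Psi> u t) (\<Psi> v t) \<le> 1/2 * dist u v"
        unfolding \<Psi> by (simp add: \<Phi>_def dist_real_def right_diff_distrib[symmetric] abs_mult)
    qed
  qed auto
  then obtain u where u: "\<Psi> u = u" by blast
  have "w u t = y0 + G u t" for t
    unfolding w_def by (subst u[symmetric], subst \<Psi>)
      (simp add: \<Phi>_def mult.assoc[symmetric] exp_add[symmetric])
  then have w: "w u = (\<lambda>t. y0 + G u t)" by blast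
  have "((\<lambda>t. y0 + G u t) has_real_derivative f t (w u t)) (at t)" for t
    by (auto intro!: derivative_eq_intros G)
  then show ?thesis using G0 w by (intro exI[of _ "w u"]) auto
qed

lemma picard_lindelof:
  fixes f :: "real \<Rightarrow> real \<Rightarrow> real"
  assumes lip: "\<And>t x y. \<bar>f t x - f t y\<bar> \<le> L * \<bar>x - y\<bar>"
    and cont: "continuous_on UNIV (\<lambda>p. f (fst p) (snd p))"
    and bd: "\<And>t x. \<bar>f t x\<bar> \<le> M"
  shows "\<exists>Y. Y t0 = y0 \<and> (\<forall>t. (Y has_real_derivative f t (Y t)) (at t))"
proof -
  \<comment> \<open>\<open>picard_lindelof_0\<close> asks for a positive constant, hence
    \<open>\<bar>L\<bar> + 1\<close>; the initial time is moved to \<open>0\<close>.\<close>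
  have "\<bar>f (t + t0) x - f (t + t0) y\<bar> \<le> (\<bar>L\<bar> + 1) * \<bar>x - y\<bar>" for t x y
  proof -
    have "L * \<bar>x - y\<bar> \<le> (\<bar>L\<bar> + 1) * \<bar>x - y\<bar>" by (rule mult_right_mono) auto
    then show ?thesis using lip[of "t + t0" x y] by linarith
  qed
  moreover have "continuous_on UNIV (\<lambda>p. f (fst p + t0) (snd p))"
  proof -
    have "continuous_on UNIV (\<lambda>p. (fst p + t0, snd p))" by (intro continuous_intros)
    from continuous_on_compose2[OF cont this] show ?thesis by auto
  qed
  ultimately obtain Y where Y: "Y 0 = y0" "\<And>t. (Y has_real_derivative f (t + t0) (Y t)) (at t)"
    using picard_lindelof_0[of "\<lambda>t. f (t + t0)" "\<bar>L\<bar> + 1" M y0] bd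
    by (metis abs_ge_zero add_nonneg_pos zero_less_one)
  have "((\<lambda>t. Y (t - t0)) has_real_derivative f t (Y (t - t0))) (at t)" for t
    using Y(2)[of "t - t0"] DERIV_shift[of Y "f t (Y (t - t0))" t "- t0"] by simp
  then show ?thesis using Y(1) by (intro exI[of _ "\<lambda>t. Y (t - t0)"]) auto
qed

section \<open>Trajectories\<close>

text \<open>In terms of \<open>s = xb - k * x\<close> the inequality is \<open>s < 2 * xb\<close>:
  an index is admissible exactly until the line of the opposite index is reached.\<close>

lemma valid_state_iff:
  assumes "xb > 0"
  shows "valid_state xb (p, k) \<longleftrightarrow> k \<in> {-1, 1} \<and> of_int k * fst p > - xb"
  using assms by (auto simp: valid_state_def)

lemma trajectoryD:
  assumes "trajectory F xb z"
  shows "continuous_on {0..} (\<lambda>t. fst (z t))"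
    and "t \<ge> 0 \<Longrightarrow> valid_state xb (z t)"
    and "finite {t\<in>{0..\<tau>}. on_line xb (z t)}"
    and "0 \<le> a \<Longrightarrow> a < b \<Longrightarrow> (\<And>u. a < u \<Longrightarrow> u < b \<Longrightarrow> \<not> on_line xb (z u)) \<Longrightarrow> a < u \<Longrightarrow> u < b \<Longrightarrow>
      snd (z u) = snd (z a) \<and>
      ((\<lambda>v. fst (z v)) has_vector_derivative F (snd (z a)) (fst (z u))) (at u)"
proof -
  show "continuous_on {0..} (\<lambda>t. fst (z t))"
    and "t \<ge> 0 \<Longrightarrow> valid_state xb (z t)"
    and "finite {t\<in>{0..\<tau>}. on_line xb (z t)}"
    using assms unfolding trajectory_def by blast+
  assume *: "0 \<le> a" "a < b" "\<And>u. a < u \<Longrightarrow> u < b \<Longrightarrow> \<not> on_line xb (z u)" "a < u" "u < b"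
  then have "\<forall>u\<in>{a<..<b}. \<not> on_line xb (z u)" by simp
  then have "\<forall>u\<in>{a<..<b}. snd (z u) = snd (z a)
      \<and> ((\<lambda>v. fst (z v)) has_vector_derivative F (snd (z a)) (fst (z u))) (at u)"
    using assms *(1,2) unfolding trajectory_def by blast
  then show "snd (z u) = snd (z a) \<and>
      ((\<lambda>v. fst (z v)) has_vector_derivative F (snd (z a)) (fst (z u))) (at u)"
    using *(4,5) by simp
qed

lemma has_vector_derivative_shift:
  assumes "(f has_vector_derivative D) (at (u + a))"
  shows "((\<lambda>v. f (v + a)) has_vector_derivative D) (at (u :: real))"
proof -
  have "((\<lambda>v. v + a) has_vector_derivative 1) (at u)"
    by (auto intro!: derivative_eq_intros)
  from vector_diff_chain_at[OF this, of f D] assms show ?thesis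
    by (simp add: o_def)
qed

lemma trajectory_shift:
  assumes z: "trajectory F xb z" and a: "a \<ge> 0"
  shows "trajectory F xb (\<lambda>t. z (t + a))"
  unfolding trajectory_def
proof (intro conjI allI impI)
  show "continuous_on {0..} (\<lambda>t. fst (z (t + a)))"
    by (rule continuous_on_compose2[OF trajectoryD(1)[OF z]]) (use a in \<open>auto intro!: continuous_intros\<close>)
  show "valid_state xb (z (t + a))" if "0 \<le> t" for t
    using trajectoryD(2)[OF z] that a by simp
  show "finite {t \<in> {0..\<tau>}. on_line xb (z (t + a))}" for \<tau>
  proof (rule finite_subset)
    show "{t \<in> {0..\<tau>}. on_line xb (z (t + a))} \<subseteq>
        (\<lambda>t. t - a) ` {t \<in> {0..\<tau> + a}. on_line xb (z t)}"
    proof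
      fix t assume "t \<in> {t \<in> {0..\<tau>}. on_line xb (z (t + a))}"
      then show "t \<in> (\<lambda>t. t - a) ` {t \<in> {0..\<tau> + a}. on_line xb (z t)}"
        using a by (intro image_eqI[of _ _ "t + a"]) auto
    qed
  qed (use trajectoryD(3)[OF z] in auto)
  fix s t assume st: "0 \<le> s \<and> s < t \<and> (\<forall>u\<in>{s<..<t}. \<not> on_line xb (z (u + a)))"
  have nl: "\<not> on_line xb (z u)" if "s + a < u" "u < t + a" for u
  proof -
    have "u - a \<in> {s<..<t}" using that by auto
    then have "\<not> on_line xb (z (u - a + a))" using st by blast
    then show ?thesis by simp
  qed
  show "\<forall>u\<in>{s<..<t}. snd (z (u + a)) = snd (z (s + a)) \<and>
      ((\<lambda>v. fst (z (v + a))) has_vector_derivative F (snd (z (s + a))) (fst (z (u + a)))) (at u)"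
  proof
    fix u assume u: "u \<in> {s<..<t}"
    have "snd (z (u + a)) = snd (z (s + a)) \<and>
      ((\<lambda>v. fst (z v)) has_vector_derivative F (snd (z (s + a))) (fst (z (u + a)))) (at (u + a))"
      by (rule trajectoryD(4)[OF z, of "s + a" "t + a"]) (use st a u nl in auto)
    then show "snd (z (u + a)) = snd (z (s + a)) \<and>
      ((\<lambda>v. fst (z (v + a))) has_vector_derivative F (snd (z (s + a))) (fst (z (u + a)))) (at u)"
      using has_vector_derivative_shift[of "\<lambda>v. fst (z v)"] by blast
  qed
next
  fix t :: real assume "0 \<le> t" "on_line xb (z (t + a))"
  then show "fst (F (snd (z (t + a))) (fst (z (t + a)))) \<noteq> 0"
    using z a unfolding trajectory_def by auto
next
  fix t :: real assume "0 < t" "on_line xb (z (t + a))"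
  then obtain j where j: "\<forall>\<^sub>F s in at_left (t + a). snd (z s) = j" "fst (F j (fst (z (t + a)))) \<noteq> 0"
    using z a unfolding trajectory_def by (metis add_pos_nonneg)
  then obtain b where b: "b < t + a" "\<And>y. b < y \<Longrightarrow> y < t + a \<Longrightarrow> snd (z y) = j"
    by (auto simp: eventually_at_left_field)
  have "\<forall>\<^sub>F s in at_left t. snd (z (s + a)) = j"
    unfolding eventually_at_left_field using b by (intro exI[of _ "b - a"]) auto
  then show "\<exists>j. (\<forall>\<^sub>F s in at_left t. snd (z (s + a)) = j) \<and> fst (F j (fst (z (t + a)))) \<noteq> 0"
    using j by blast
qed

text \<open>Finiteness of the hits up to \<open>t + 1\<close> isolates every time; \<open>t\<close>
  may be a hit itself, hence the exception.\<close>

lemma trajectory_no_hits_near: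
  assumes z: "trajectory F xb z"
  obtains \<eta> where "\<eta> > 0" "\<And>u. u \<ge> 0 \<Longrightarrow> u \<noteq> t \<Longrightarrow> \<bar>u - t\<bar> < \<eta> \<Longrightarrow> \<not> on_line xb (z u)"
proof -
  obtain d where d: "d > 0" "\<And>x. x \<in> {u\<in>{0..t + 1}. on_line xb (z u)} \<Longrightarrow> x \<noteq> t \<Longrightarrow> d \<le> dist t x"
    using finite_set_avoid[OF trajectoryD(3)[OF z, of "t + 1"]] by blast
  show ?thesis
  proof (rule that[of "min d 1"])
    fix u assume u: "0 \<le> u" "u \<noteq> t" "\<bar>u - t\<bar> < min d 1"
    then have "u \<le> t + 1" "\<not> d \<le> dist t u" by (auto simp: dist_real_def)
    then show "\<not> on_line xb (z u)" using d(2)[of u] u by auto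
  qed (use d in auto)
qed

text \<open>The squared distance, weighted by \<open>exp (- (2 * L * u))\<close>, does not increase.
  Derivatives are asked for on the open interval only, since a trajectory need not be differentiable
  at a hit, and the Lipschitz bound only along the two curves, so that a local constant is
  enough.\<close>

lemma ode_unique:
  fixes p q :: "real \<Rightarrow> 'a :: real_inner"
  assumes ab: "a \<le> b"
    and cp: "continuous_on {a..b} p" and cq: "continuous_on {a..b} q"
    and dp: "\<And>u. a < u \<Longrightarrow> u < b \<Longrightarrow> (p has_vector_derivative f (p u)) (at u)"
    and dq: "\<And>u. a < u \<Longrightarrow> u < b \<Longrightarrow> (q has_vector_derivative f (q u)) (at u)"
    and lip: "\<And>u. a < u \<Longrightarrow> u < b \<Longrightarrow> norm (f (p u) - f (q u)) \<le> L * norm (p u - q u)"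
    and eq: "p a = q a"
  shows "p b = q b"
proof -
  define g where "g u = (p u - q u) \<bullet> (p u - q u) * exp (- (2 * L * u))" for u
  have "g b \<le> g a"
  proof (rule DERIV_nonpos_imp_decreasing_open[OF ab])
    show "continuous_on {a..b} g" unfolding g_def by (intro continuous_intros cp cq)
    fix u assume u: "a < u" "u < b"
    have *: "((\<lambda>u. p u - q u) has_vector_derivative f (p u) - f (q u)) (at u)"
      by (intro derivative_intros dp dq u)
    have "((\<lambda>u. (p u - q u) \<bullet> (p u - q u)) has_vector_derivative
        (p u - q u) \<bullet> (f (p u) - f (q u)) + (f (p u) - f (q u)) \<bullet> (p u - q u)) (at u)"
      by (rule bounded_bilinear.has_vector_derivative[OF bounded_bilinear_inner * *])
    then have d: "((\<lambda>u. (p u - q u) \<bullet> (p u - q u)) has_real_derivative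
        2 * ((p u - q u) \<bullet> (f (p u) - f (q u)))) (at u)"
      by (simp add: has_real_derivative_iff_has_vector_derivative inner_commute)
    have "((\<lambda>u. exp (- (2 * L * u))) has_real_derivative - (2 * L) * exp (- (2 * L * u))) (at u)"
      by (auto intro!: derivative_eq_intros)
    from DERIV_mult[OF d this] have "(g has_real_derivative 2 * ((p u - q u) \<bullet> (f (p u) - f (q u))
        - L * ((p u - q u) \<bullet> (p u - q u))) * exp (- (2 * L * u))) (at u)"
      unfolding g_def by (rule DERIV_cong) (simp add: left_diff_distrib right_diff_distrib)
    moreover have "(p u - q u) \<bullet> (f (p u) - f (q u)) \<le> L * ((p u - q u) \<bullet> (p u - q u))"
    proof -
      have "(p u - q u) \<bullet> (f (p u) - f (q u)) \<le> norm (p u - q u) * norm (f (p u) - f (q u))"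
        by (rule norm_cauchy_schwarz)
      also have "\<dots> \<le> norm (p u - q u) * (L * norm (p u - q u))"
        by (intro mult_left_mono lip u) simp
      finally show ?thesis by (simp add: dot_square_norm power2_eq_square mult_ac)
    qed
    ultimately show "\<exists>y. (g has_real_derivative y) (at u) \<and> y \<le> 0"
      by (metis (no_types, lifting) diff_le_0_iff_le exp_ge_zero mult_nonneg_nonpos mult_nonpos_nonneg zero_le_numeral)
  qed
  then have "(p b - q b) \<bullet> (p b - q b) \<le> 0"
    using eq by (simp add: g_def mult_le_0_iff)
  then show ?thesis by (metis antisym inner_ge_zero inner_eq_zero_iff eq_iff_diff_eq_0)
qed

text \<open>The index at a hit is prescribed by \<^const>\<open>valid_state\<close>, hits do not accumulate and between
  them the field is locally Lipschitz, so the first time of disagreement cannot exist.\<close>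

theorem trajectory_unique:
  assumes w: "trajectory F xb w" and v: "trajectory F xb v" and eq: "w 0 = v 0" and xb: "xb > 0"
    and lip: "\<And>k p. \<exists>e>0. \<exists>L. \<forall>q\<in>ball p e. \<forall>q'\<in>ball p e. norm (F k q - F k q') \<le> L * norm (q - q')"
    and t: "t \<ge> 0"
  shows "w t = v t"
proof (rule ccontr)
  assume ne: "w t \<noteq> v t"
  define S where "S = {t. 0 \<le> t \<and> w t \<noteq> v t}"
  define t0 where "t0 = Inf S"
  have S: "S \<noteq> {}" "bdd_below S" using ne t by (auto simp: S_def intro: bdd_belowI[of _ 0])
  have t0: "t0 \<ge> 0" unfolding t0_def by (rule cInf_greatest[OF S(1)]) (auto simp: S_def)
  have before: "w u = v u" if "0 \<le> u" "u < t0" for u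
    using that cInf_lower[OF _ S(2), of u] by (force simp: S_def t0_def)
  obtain \<eta> where \<eta>: "\<eta> > 0" "\<And>u. u \<ge> 0 \<Longrightarrow> u \<noteq> t0 \<Longrightarrow> \<bar>u - t0\<bar> < \<eta> \<Longrightarrow> \<not> on_line xb (w u)"
    using trajectory_no_hits_near[OF w] by blast
  obtain \<eta>' where \<eta>': "\<eta>' > 0" "\<And>u. u \<ge> 0 \<Longrightarrow> u \<noteq> t0 \<Longrightarrow> \<bar>u - t0\<bar> < \<eta>' \<Longrightarrow> \<not> on_line xb (v u)"
    using trajectory_no_hits_near[OF v] by blast
  define h where "h = min \<eta> \<eta>'"
  have h: "h > 0" "\<And>u. u \<ge> 0 \<Longrightarrow> u \<noteq> t0 \<Longrightarrow> \<bar>u - t0\<bar> < h \<Longrightarrow> \<not> on_line xb (w u) \<and> \<not> on_line xb (v u)"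
    using \<eta> \<eta>' by (auto simp: h_def)
  \<comment> \<open>Positions pass to the limit \<open>t0\<close> by continuity. Indices do not, and
    need a case distinction on whether \<open>t0\<close> is a hit.\<close>
  have at_t0: "w t0 = v t0"
  proof (cases "t0 = 0")
    case True
    then show ?thesis using eq by simp
  next
    case False
    then have pos: "t0 > 0" using t0 by simp
    have pe: "fst (w t0) = fst (v t0)"
    proof -
      have c: "continuous_on {0..t0} (\<lambda>u. fst (w u) - fst (v u))"
        by (intro continuous_intros continuous_on_subset[OF trajectoryD(1)[OF w]]
          continuous_on_subset[OF trajectoryD(1)[OF v]]) auto
      have "closure {0..<t0} = {0..t0}" using pos by simp
      then have "fst (w t0) - fst (v t0) = 0"
        using continuous_constant_on_closure[of "{0..<t0}" "\<lambda>u. fst (w u) - fst (v u)" 0 t0] c before t0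
        by auto
      then show ?thesis by simp
    qed
    have "snd (w t0) = snd (v t0)"
    proof (cases "on_line xb (w t0)")
      case True
      then show ?thesis
        using trajectoryD(2)[OF w t0] trajectoryD(2)[OF v t0] pe xb
        by (auto simp: on_line_def valid_state_def)
    next
      case False
      then have nl: "\<not> on_line xb (v t0)" using pe by (simp add: on_line_def)
      \<comment> \<open>Without a hit at \<open>t0\<close>, the open interval from \<open>a\<close>
        to \<open>t0 + h\<close> is free of hits and contains \<open>t0\<close>; so each index at
        \<open>t0\<close> equals the one at \<open>a\<close>, where both trajectories still
        agree.\<close>
      define a where "a = max 0 (t0 - h / 2)"
      have a: "a \<ge> 0" "a < t0" "t0 - a < h" using pos h(1) by (auto simp: a_def)
      have "\<not> on_line xb (w u) \<and> \<not> on_line xb (v u)" if "a < u" "u < t0 + h" for u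
        using h(2)[of u] a that False nl by (cases "u = t0") auto
      then have "snd (w t0) = snd (w a)" "snd (v t0) = snd (v a)"
        using trajectoryD(4)[OF w, of a "t0 + h" t0] trajectoryD(4)[OF v, of a "t0 + h" t0] a h(1)
        by auto
      then show ?thesis using before[of a] a by simp
    qed
    with pe show ?thesis by (simp add: prod_eq_iff)
  qed
  define k where "k = snd (w t0)"
  obtain e L where e: "e > 0" and L: "\<And>q q'. q \<in> ball (fst (w t0)) e \<Longrightarrow> q' \<in> ball (fst (w t0)) e \<Longrightarrow>
      norm (F k q - F k q') \<le> L * norm (q - q')"
    using lip by meson
  have near: "\<exists>d>0. \<forall>u. t0 \<le> u \<longrightarrow> u < t0 + d \<longrightarrow> fst (z u) \<in> ball (fst (w t0)) e"
    if z: "trajectory F xb z" "z t0 = w t0" for z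
  proof -
    obtain d where "d > 0" "\<And>u. u \<ge> 0 \<Longrightarrow> dist u t0 < d \<Longrightarrow> dist (fst (z u)) (fst (z t0)) < e"
      using trajectoryD(1)[OF z(1)] t0 e unfolding continuous_on_iff
      by (metis atLeast_iff)
    then show ?thesis using z(2) t0 by (intro exI[of _ d]) (auto simp: dist_commute dist_real_def)
  qed
  obtain d where d: "d > 0" "\<And>u. t0 \<le> u \<Longrightarrow> u < t0 + d \<Longrightarrow> fst (w u) \<in> ball (fst (w t0)) e"
    using near[OF w refl] by blast
  obtain d' where d': "d' > 0" "\<And>u. t0 \<le> u \<Longrightarrow> u < t0 + d' \<Longrightarrow> fst (v u) \<in> ball (fst (w t0)) e"
    using near[OF v at_t0[symmetric]] by blast
  define r where "r = min h (min d d')"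
  have r: "r > 0" using h d d' by (simp add: r_def)
  have W: "snd (w u) = k \<and> ((\<lambda>v. fst (w v)) has_vector_derivative F k (fst (w u))) (at u)"
    if "t0 < u" "u < t0 + r" for u
    unfolding k_def by (rule trajectoryD(4)[OF w, of t0 "t0 + r"]) (use that t0 h r_def in auto)
  have V: "snd (v u) = k \<and> ((\<lambda>t. fst (v t)) has_vector_derivative F k (fst (v u))) (at u)"
    if "t0 < u" "u < t0 + r" for u
    unfolding k_def at_t0 by (rule trajectoryD(4)[OF v, of t0 "t0 + r"]) (use that t0 h r_def in auto)
  have after: "w u = v u" if u: "t0 \<le> u" "u < t0 + r" for u
  proof (cases "u = t0")
    case False
    have "fst (w u) = fst (v u)"
    proof (rule ode_unique[OF u(1), of "\<lambda>t. fst (w t)" "\<lambda>t. fst (v t)" "F k" L])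
      show "continuous_on {t0..u} (\<lambda>t. fst (w t))" "continuous_on {t0..u} (\<lambda>t. fst (v t))"
        using t0 by (auto intro: continuous_on_subset[OF trajectoryD(1)[OF w]]
          continuous_on_subset[OF trajectoryD(1)[OF v]])
      fix s assume "t0 < s" "s < u"
      then show "((\<lambda>t. fst (w t)) has_vector_derivative F k (fst (w s))) (at s)"
        "((\<lambda>t. fst (v t)) has_vector_derivative F k (fst (v s))) (at s)"
        "norm (F k (fst (w s)) - F k (fst (v s))) \<le> L * norm (fst (w s) - fst (v s))"
        using W V u d d' by (auto intro!: L simp: r_def)
    qed (use at_t0 in simp)
    then show ?thesis using W[of u] V[of u] u False by (simp add: prod_eq_iff)
  qed (use at_t0 in simp)
  have "t0 + r \<le> Inf S"
  proof (rule cInf_greatest[OF S(1)])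
    fix u assume "u \<in> S"
    then show "t0 + r \<le> u" using before[of u] after[of u]
      by (cases "u < t0"; cases "u < t0 + r") (auto simp: S_def)
  qed
  then show False using r t0_def by simp
qed

lemma increasing_cover:
  fixes t :: "nat \<Rightarrow> real"
  assumes "t 0 \<le> u" "\<And>x. \<exists>n. x < t n"
  shows "\<exists>n. t n \<le> u \<and> u < t (Suc n)"
proof -
  have l: "u < t (LEAST m. u < t m)" using assms(2) by (rule LeastI_ex)
  then have "(LEAST m. u < t m) \<noteq> 0" using assms(1) by (metis not_le)
  then obtain n where n: "(LEAST m. u < t m) = Suc n" by (metis not0_implies_Suc)
  then have "\<not> u < t n" by (metis lessI not_less_Least)
  then show ?thesis using l n by (intro exI[of _ n]) auto
qed

text \<open>Positions are given on closed intervals, indices on half-open ones, because at a hit the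
  index already has its new value. A piece may meet a line in its interior, as long as the
  prescribed index is its own; \<open>fin\<close> and \<open>trans\<close> cover such hits.\<close>

lemma trajectory_concat:
  fixes t :: "nat \<Rightarrow> real" and p :: "nat \<Rightarrow> real \<Rightarrow> real \<times> real" and \<kappa> :: "nat \<Rightarrow> int"
  assumes t0: "t 0 = 0" and inc: "\<And>n. t n < t (Suc n)" and unb: "\<And>\<tau>. \<exists>n. \<tau> < t n"
    and der: "\<And>n u. t n \<le> u \<Longrightarrow> u \<le> t (Suc n) \<Longrightarrow> (p n has_vector_derivative F (\<kappa> n) (p n u)) (at u)"
    and glue: "\<And>n. p n (t (Suc n)) = p (Suc n) (t (Suc n))"
    and val: "\<And>n u. t n \<le> u \<Longrightarrow> u < t (Suc n) \<Longrightarrow> valid_state xb (p n u, \<kappa> n)"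
    and hit: "\<And>n. fst (p n (t (Suc n))) \<in> {xb, - xb}"
    and fin: "\<And>n. finite {u\<in>{t n..t (Suc n)}. fst (p n u) \<in> {xb, - xb}}"
    and trans: "\<And>n u. t n \<le> u \<Longrightarrow> u \<le> t (Suc n) \<Longrightarrow> fst (F (\<kappa> n) (p n u)) \<noteq> 0"
  shows "\<exists>v. trajectory F xb v \<and> (\<forall>n u. t n \<le> u \<and> u < t (Suc n) \<longrightarrow> v u = (p n u, \<kappa> n))"
proof -
  have sm: "strict_mono t" using inc by (simp add: strict_mono_Suc_iff)
  define N where "N u = (LEAST n. u < t (Suc n))" for u
  define v where "v u = (p (N u) u, \<kappa> (N u))" for u
  have N: "N u = n" if "t n \<le> u" "u < t (Suc n)" for n u
    unfolding N_def
  proof (rule Least_equality)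
    fix m assume "u < t (Suc m)"
    then have "t n < t (Suc m)" using that by linarith
    then show "n \<le> m" using strict_mono_less[OF sm] by simp
  qed (use that in auto)
  have v: "v u = (p n u, \<kappa> n)" if "t n \<le> u" "u < t (Suc n)" for n u
    using N[OF that] by (simp add: v_def)
  have v': "fst (v u) = p n u" if "t n \<le> u" "u \<le> t (Suc n)" for n u
  proof (cases "u = t (Suc n)")
    case True
    then show ?thesis using v[of "Suc n" u] inc[of "Suc n"] glue by simp
  qed (use v that in auto)
  \<comment> \<open>Open on the left: at a switching time this selects the piece that ends there,
    whose index is the one active just before. \<open>ex'\<close> selects the piece that
    begins.\<close>
  have ex: "\<exists>n. t n < u \<and> u \<le> t (Suc n)" if "0 < u" for u
  proof -
    obtain m where "u \<le> t m" using unb[of u] by (meson less_imp_le)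
    then have l: "u \<le> t (LEAST m. u \<le> t m)" by (rule LeastI)
    then have "(LEAST m. u \<le> t m) \<noteq> 0" using that t0 by (metis not_le)
    then obtain n where n: "(LEAST m. u \<le> t m) = Suc n" by (metis not0_implies_Suc)
    then have "\<not> u \<le> t n" by (metis lessI not_less_Least)
    then show ?thesis using l n by (intro exI[of _ n]) auto
  qed
  have ex': "\<exists>n. t n \<le> u \<and> u < t (Suc n)" if "0 \<le> u" for u
    by (rule increasing_cover) (use that t0 unb in auto)
  have tn: "t n \<ge> 0" for n using sm t0 by (metis strict_mono_less_eq le0)
  have cont_n: "continuous_on {0..t n} (\<lambda>u. fst (v u))" for n
  proof (induction n)
    case (Suc n)
    have "continuous_on {t n..t (Suc n)} (p n)"
      by (rule continuous_at_imp_continuous_on)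
        (use der has_vector_derivative_continuous in \<open>force\<close>)
    then have "continuous_on {t n..t (Suc n)} (\<lambda>u. fst (v u))"
      by (rule continuous_on_eq) (use v' in auto)
    moreover have "{0..t (Suc n)} = {0..t n} \<union> {t n..t (Suc n)}"
      using tn[of n] inc[of n] by auto
    ultimately show ?case using Suc by (auto intro: continuous_on_closed_Un)
  qed (simp add: t0)
  have "trajectory F xb v"
    unfolding trajectory_def
  proof (intro conjI allI impI)
    show "continuous_on {0..} (\<lambda>t. fst (v t))"
      unfolding continuous_on_eq_continuous_within
    proof
      fix u :: real assume u: "u \<in> {0..}"
      obtain n where n: "u < t n" using unb by blast
      have "at u within {0..} = at u within {0..t n}"
        by (rule at_within_nhd[of u "{..<t n}"]) (use n in auto)
      then show "continuous (at u within {0..}) (\<lambda>t. fst (v t))"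
        using cont_n[of n] u n unfolding continuous_on_eq_continuous_within by auto
    qed
    show "valid_state xb (v u)" if "0 \<le> u" for u
      using ex'[OF that] v val by auto
    show "finite {u \<in> {0..\<tau>}. on_line xb (v u)}" for \<tau>
    proof -
      obtain m where m: "\<tau> < t m" using unb by blast
      show ?thesis
      proof (rule finite_subset)
        show "{u \<in> {0..\<tau>}. on_line xb (v u)} \<subseteq> (\<Union>n<m. {u\<in>{t n..t (Suc n)}. fst (p n u) \<in> {xb, - xb}})"
        proof
          fix u assume "u \<in> {u \<in> {0..\<tau>}. on_line xb (v u)}"
          then have u: "0 \<le> u" "u \<le> \<tau>" "on_line xb (v u)" by auto
          obtain n where n: "t n \<le> u" "u < t (Suc n)" using ex' u by blast
          then have "t n < t m" using u m by linarith
          then have "n < m" using strict_mono_less[OF sm] by simp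
          then show "u \<in> (\<Union>n<m. {u\<in>{t n..t (Suc n)}. fst (p n u) \<in> {xb, - xb}})"
            using n u v[OF n] by (auto simp: on_line_def)
        qed
      qed (use fin in auto)
    qed
    fix a b assume st: "0 \<le> a \<and> a < b \<and> (\<forall>u\<in>{a<..<b}. \<not> on_line xb (v u))"
    obtain n where n: "t n \<le> a" "a < t (Suc n)" using ex' st by blast
    \<comment> \<open>Every piece ends on a line, so an interval free of hits cannot extend beyond
      it.\<close>
    have b: "b \<le> t (Suc n)"
    proof (rule ccontr)
      assume "\<not> ?thesis"
      then have "\<not> on_line xb (v (t (Suc n)))" using st n by auto
      then show False using hit[of n] v'[of n "t (Suc n)"] inc[of n] by (auto simp: on_line_def)
    qed
    show "\<forall>u\<in>{a<..<b}. snd (v u) = snd (v a) \<and>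
        ((\<lambda>s. fst (v s)) has_vector_derivative F (snd (v a)) (fst (v u))) (at u)"
    proof
      fix u assume u: "u \<in> {a<..<b}"
      have "(p n has_vector_derivative F (\<kappa> n) (p n u)) (at u)"
        using der u n b by auto
      then have "((\<lambda>s. fst (v s)) has_vector_derivative F (\<kappa> n) (p n u)) (at u)"
        by (rule has_vector_derivative_transform_within_open[of _ _ _ "{a<..<b}"])
          (use u n b v'[of n] in auto)
      then show "snd (v u) = snd (v a) \<and>
        ((\<lambda>s. fst (v s)) has_vector_derivative F (snd (v a)) (fst (v u))) (at u)"
        using v[of n u] v[of n a] u n b by auto
    qed
  next
    fix u :: real assume "0 \<le> u" "on_line xb (v u)"
    then obtain n where n: "t n \<le> u" "u < t (Suc n)" using ex' by blast
    then show "fst (F (snd (v u)) (fst (v u))) \<noteq> 0" using v[OF n] trans by auto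
  next
    fix u :: real assume "0 < u" "on_line xb (v u)"
    then obtain n where n: "t n < u" "u \<le> t (Suc n)" using ex by blast
    have "\<forall>\<^sub>F s in at_left u. snd (v s) = \<kappa> n"
      unfolding eventually_at_left_field using n v[of n] by (intro exI[of _ "t n"]) auto
    moreover have "fst (F (\<kappa> n) (fst (v u))) \<noteq> 0" using v'[of n u] trans n by auto
    ultimately show "\<exists>j. (\<forall>\<^sub>F s in at_left u. snd (v s) = j) \<and> fst (F j (fst (v u))) \<noteq> 0" by blast
  qed
  with v show ?thesis by blast
qed

section \<open>The return map near the origin\<close>

lemma lipschitz2_continuous:
  fixes g :: "real \<Rightarrow> real \<Rightarrow> real"
  assumes "\<And>x y x' y'. \<bar>g x y - g x' y'\<bar> \<le> L * (\<bar>x - x'\<bar> + \<bar>y - y'\<bar>)"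
  shows "continuous_on UNIV (\<lambda>p. g (fst p) (snd p))"
proof -
  have "0 \<le> L" using assms[of 0 0 1 0] by simp
  have "(2 * L)-lipschitz_on UNIV (\<lambda>p. g (fst p) (snd p))"
  proof (rule lipschitz_onI)
    fix p q :: "real \<times> real"
    have "dist (g (fst p) (snd p)) (g (fst q) (snd q))
       \<le> L * (dist (fst p) (fst q) + dist (snd p) (snd q))"
      using assms by (simp add: dist_real_def)
    also have "\<dots> \<le> L * (dist p q + dist p q)"
      by (intro mult_left_mono add_mono dist_fst_le dist_snd_le \<open>0 \<le> L\<close>)
    finally show "dist (g (fst p) (snd p)) (g (fst q) (snd q)) \<le> 2 * L * dist p q" by simp
  qed (use \<open>0 \<le> L\<close> in simp)
  then show ?thesis by (rule lipschitz_on_continuous_on)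
qed

text \<open>A mean value estimate against a reference slope \<open>c\<close>: the choice
  \<open>c = 0\<close> gives Lipschitz bounds, the slope at the origin a first order
  expansion.\<close>

lemma real_deriv_bound:
  fixes f :: "real \<Rightarrow> real"
  assumes ab: "a \<le> b" and "\<And>t. a \<le> t \<Longrightarrow> t \<le> b \<Longrightarrow> (f has_real_derivative f' t) (at t)"
    and "\<And>t. a \<le> t \<Longrightarrow> t \<le> b \<Longrightarrow> \<bar>f' t - c\<bar> \<le> B"
  shows "\<bar>f b - f a - c * (b - a)\<bar> \<le> B * (b - a)"
proof (cases "a = b")
  case False
  then have "a < b" using ab by simp
  then obtain t where t: "a < t" "t < b" "f b - f a = (b - a) * f' t"
    using MVT2[of a b f f'] assms(2) by auto
  have "f b - f a - c * (b - a) = (f' t - c) * (b - a)"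
    using t(3) by (simp add: algebra_simps)
  then show ?thesis using assms(3)[of t] t ab by (simp add: abs_mult mult_right_mono)
qed simp

text \<open>Makes the exponential contraction factor of the return map linear in \<open>xb\<close>,
  through \<open>exp (- u) \<le> 1 / (1 + u)\<close>.\<close>

lemma exp_neg_le:
  fixes u :: real
  assumes "0 \<le> u" "u \<le> 1"
  shows "exp (- u) \<le> 1 - u / 2"
proof -
  have "exp (- u) \<le> 1 / (1 + u)"
    using exp_ge_add_one_self[of u] assms by (simp add: exp_minus field_simps)
  also have "\<dots> \<le> 1 - u / 2"
  proof -
    have "1 \<le> (1 - u / 2) * (1 + u)" using mult_left_mono[OF assms(2,1)] by (simp add: algebra_simps)
    then show ?thesis using assms by (simp add: pos_divide_le_eq)
  qed
  finally show ?thesis .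
qed

text \<open>In the coordinates \<open>s = xb - k * x\<close> and \<open>y\<close> a state of index \<open>k\<close> moves from \<open>s = 0\<close> to
  \<open>s = 2 * xb\<close>, where \<open>k\<close> changes its sign and \<open>s\<close> jumps back to \<open>0\<close>.  Here \<open>\<phi> k\<close> is the speed
  \<open>ds/dt\<close> and \<open>h k\<close> the slope \<open>dy/ds\<close>, both extended from the box of radius \<open>r\<close> to the plane.\<close>

locale hysteresis =
  fixes F :: "int \<Rightarrow> real \<times> real \<Rightarrow> real \<times> real"
    and h \<phi> :: "int \<Rightarrow> real \<Rightarrow> real \<Rightarrow> real" and \<alpha> :: "int \<Rightarrow> real"
    and r L M m m' :: real
  assumes h_lip: "\<And>k x y x' y'. \<bar>h k x y - h k x' y'\<bar> \<le> L * (\<bar>x - x'\<bar> + \<bar>y - y'\<bar>)"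
    and phi_lip: "\<And>k x y x' y'. \<bar>\<phi> k x y - \<phi> k x' y'\<bar> \<le> L * (\<bar>x - x'\<bar> + \<bar>y - y'\<bar>)"
    and h_bd: "\<And>k x y. \<bar>h k x y\<bar> \<le> M"
    and phi_lo: "\<And>k x y. m \<le> \<phi> k x y" and phi_hi: "\<And>k x y. \<phi> k x y \<le> m'"
    and m_pos: "m > 0" and r_pos: "r > 0"
    and field: "\<And>k x y. k \<in> {-1, 1} \<Longrightarrow> \<bar>x\<bar> \<le> r \<Longrightarrow> \<bar>y\<bar> \<le> r \<Longrightarrow>
      F k (x, y) = (- of_int k * \<phi> k x y, h k x y * \<phi> k x y)"
    and one_sided: "\<And>k x y y'. k \<in> {-1, 1} \<Longrightarrow> \<bar>x\<bar> \<le> r \<Longrightarrow> \<bar>y\<bar> \<le> r \<Longrightarrow> \<bar>y'\<bar> \<le> r \<Longrightarrow>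
      (y - y') * (h k x y - h k x y') \<le> \<alpha> k * (y - y')\<^sup>2"
    and alpha: "\<alpha> 1 + \<alpha> (-1) < 0"
    and balance: "h 1 0 0 + h (-1) 0 0 = 0"
    and loc_lip: "\<And>k p. \<exists>e>0. \<exists>L. \<forall>q\<in>ball p e. \<forall>q'\<in>ball p e.
      norm (F k q - F k q') \<le> L * norm (q - q')"
begin

lemma L_nonneg: "0 \<le> L" using h_lip[of 0 0 0 1 0] by simp
lemma M_nonneg: "0 \<le> M" using h_bd[of 0 0 0] by simp
lemma m'_pos: "0 < m'" using phi_lo[of 0 0 0] phi_hi[of 0 0 0] m_pos by simp
lemma phi_pos: "0 < \<phi> k x y" using phi_lo[of k x y] m_pos by simp

section \<open>Crossings of the strip as graphs over \<open>s\<close>\<close>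

definition sol :: "real \<Rightarrow> int \<Rightarrow> (real \<Rightarrow> real) \<Rightarrow> bool" where
  "sol xb k Y \<longleftrightarrow> (\<forall>s. (Y has_real_derivative h k (of_int k * (xb - s)) (Y s)) (at s))"

lemma sol_exists: "\<exists>Y. sol xb k Y \<and> Y s0 = y0"
proof -
  have "continuous_on UNIV (\<lambda>p. (of_int k * (xb - fst p), snd p))" by (intro continuous_intros)
  from continuous_on_compose2[OF lipschitz2_continuous[of "h k", OF h_lip] this]
  have "continuous_on UNIV (\<lambda>p. h k (of_int k * (xb - fst p)) (snd p))" by simp
  moreover have "\<bar>h k (of_int k * (xb - s)) y - h k (of_int k * (xb - s)) y'\<bar> \<le> L * \<bar>y - y'\<bar>" for s y y'
    using h_lip[of k "of_int k * (xb - s)" y "of_int k * (xb - s)" y'] by simp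
  ultimately have "\<exists>Y. Y s0 = y0 \<and> (\<forall>s. (Y has_real_derivative h k (of_int k * (xb - s)) (Y s)) (at s))"
    by (intro picard_lindelof[of "\<lambda>s y. h k (of_int k * (xb - s)) y" L M s0 y0] h_bd)
  then show ?thesis unfolding sol_def by blast
qed

text \<open>The crude bound with the Lipschitz constant works in both directions of \<open>s\<close>
  and outside the box. It serves for uniqueness and for carrying a deviation back to
  \<open>s = 0\<close>, a direction in which the one-sided constant \<open>\<alpha> k\<close> gives
  no estimate.\<close>

lemma sol_gronwall:
  assumes "sol xb k Y" "sol xb k Z"
  shows "\<bar>Y s - Z s\<bar> \<le> exp (L * \<bar>s - s0\<bar>) * \<bar>Y s0 - Z s0\<bar>"
proof -
  define D' where "D' s = h k (of_int k * (xb - s)) (Y s) - h k (of_int k * (xb - s)) (Z s)" for s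
  have der: "((\<lambda>s. Y s - Z s) has_real_derivative D' s) (at s)" for s
    using assms unfolding sol_def D'_def by (auto intro!: derivative_intros)
  have le: "(Y s - Z s) * D' s \<le> L * (Y s - Z s)\<^sup>2"
    and le': "(Y s - Z s) * - D' s \<le> L * (Y s - Z s)\<^sup>2" for s
  proof -
    have "\<bar>(Y s - Z s) * D' s\<bar> \<le> \<bar>Y s - Z s\<bar> * (L * \<bar>Y s - Z s\<bar>)"
      unfolding abs_mult D'_def
      by (intro mult_left_mono) (use h_lip[of k "of_int k * (xb - s)" _ "of_int k * (xb - s)"] in auto)
    also have "\<dots> = L * (\<bar>Y s - Z s\<bar> * \<bar>Y s - Z s\<bar>)" by (simp only: mult_ac)
    also have "\<dots> = L * (Y s - Z s)\<^sup>2" by (simp add: power2_eq_square)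
    finally show "(Y s - Z s) * D' s \<le> L * (Y s - Z s)\<^sup>2" "(Y s - Z s) * - D' s \<le> L * (Y s - Z s)\<^sup>2"
      by (simp_all add: abs_le_iff)
  qed
  show ?thesis
  proof (cases "s0 \<le> s")
    case True
    have "\<bar>Y s - Z s\<bar> \<le> exp (L * (s - s0)) * \<bar>Y s0 - Z s0\<bar>"
      by (rule one_sided_gronwall[OF True der le])
    then show ?thesis using True by simp
  next
    case False
    have "\<bar>(\<lambda>s. Y (- s) - Z (- s)) (- s)\<bar> \<le>
        exp (L * (- s - (- s0))) * \<bar>(\<lambda>s. Y (- s) - Z (- s)) (- s0)\<bar>"
    proof (rule one_sided_gronwall)
      show "((\<lambda>s. Y (- s) - Z (- s)) has_real_derivative - D' (- s)) (at s)" for s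
        using DERIV_mirror[of "\<lambda>s. Y s - Z s" "D' (- s)" s] der[of "- s"] by simp
    qed (use False le' in auto)
    then show ?thesis using False by simp
  qed
qed

lemma sol_unique:
  assumes "sol xb k Y" "sol xb k Z" "Y s0 = Z s0"
  shows "Y = Z"
proof
  fix s show "Y s = Z s" using sol_gronwall[OF assms(1,2), of s s0] assms(3) by simp
qed

lemma sol_lip:
  assumes "sol xb k Y"
  shows "\<bar>Y s - Y s'\<bar> \<le> M * \<bar>s - s'\<bar>"
proof -
  have *: "\<bar>Y b - Y a\<bar> \<le> M * (b - a)" if "a \<le> b" for a b
    using real_deriv_bound[of a b Y "\<lambda>s. h k (of_int k * (xb - s)) (Y s)" 0 M] assms h_bd that
    by (auto simp: sol_def)
  then show ?thesis using *[of s s'] *[of s' s] by (cases "s \<le> s'") (auto simp: abs_minus_commute)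
qed

text \<open>The sharp counterpart of \<open>sol_gronwall\<close>: forward only, and only while both
  graphs stay in the box, but with the possibly negative constant \<open>\<alpha> k\<close>.\<close>

lemma sol_contract:
  assumes "k \<in> {-1, 1}" "sol xb k Y" "sol xb k Z" "a \<le> b"
    and box: "\<And>s. a \<le> s \<Longrightarrow> s \<le> b \<Longrightarrow> \<bar>xb - s\<bar> \<le> r \<and> \<bar>Y s\<bar> \<le> r \<and> \<bar>Z s\<bar> \<le> r"
  shows "\<bar>Y b - Z b\<bar> \<le> exp (\<alpha> k * (b - a)) * \<bar>Y a - Z a\<bar>"
proof (rule one_sided_gronwall[OF \<open>a \<le> b\<close>])
  fix s assume s: "a \<le> s" "s \<le> b"
  show "((\<lambda>s. Y s - Z s) has_real_derivative
      h k (of_int k * (xb - s)) (Y s) - h k (of_int k * (xb - s)) (Z s)) (at s)"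
    using assms(2,3) unfolding sol_def by (auto intro!: derivative_intros)
  have "\<bar>of_int k * (xb - s)\<bar> = \<bar>xb - s\<bar>" using assms(1) by auto
  then show "(Y s - Z s) * (h k (of_int k * (xb - s)) (Y s) - h k (of_int k * (xb - s)) (Z s))
      \<le> \<alpha> k * (Y s - Z s)\<^sup>2"
    using one_sided[OF assms(1)] box[OF s] by simp
qed

text \<open>Restores the time that the graph \<open>Y\<close> has eliminated:
  \<open>\<sigma> t\<close> is the value of \<open>s\<close> at time \<open>t\<close>. Since
  \<open>Y\<close> is Lipschitz, this is again a scalar equation within reach of
  \<open>picard_lindelof\<close>.\<close>

definition clock :: "real \<Rightarrow> int \<Rightarrow> (real \<Rightarrow> real) \<Rightarrow> (real \<Rightarrow> real) \<Rightarrow> bool" where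
  "clock xb k Y \<sigma> \<longleftrightarrow>
    (\<forall>t. (\<sigma> has_real_derivative \<phi> k (of_int k * (xb - \<sigma> t)) (Y (\<sigma> t))) (at t))"

lemma clock_exists:
  assumes Y: "sol xb k Y"
  shows "\<exists>\<sigma>. clock xb k Y \<sigma> \<and> \<sigma> 0 = s0"
proof -
  define f where "f (t :: real) s = \<phi> k (of_int k * (xb - s)) (Y s)" for t s
  have *: "\<bar>f t s - f t s'\<bar> \<le> L * (\<bar>of_int k\<bar> + M) * \<bar>s - s'\<bar>" for t s s'
  proof -
    have "\<bar>f t s - f t s'\<bar> \<le> L * (\<bar>of_int k * (xb - s) - of_int k * (xb - s')\<bar> + \<bar>Y s - Y s'\<bar>)"
      unfolding f_def by (rule phi_lip)
    also have "\<bar>of_int k * (xb - s) - of_int k * (xb - s')\<bar> = \<bar>of_int k\<bar> * \<bar>s - s'\<bar>"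
      by (simp add: right_diff_distrib[symmetric] abs_mult abs_minus_commute)
    finally have "\<bar>f t s - f t s'\<bar> \<le> L * (\<bar>of_int k\<bar> * \<bar>s - s'\<bar> + \<bar>Y s - Y s'\<bar>)" .
    also have "\<dots> \<le> L * (\<bar>of_int k\<bar> * \<bar>s - s'\<bar> + M * \<bar>s - s'\<bar>)"
      by (intro mult_left_mono add_left_mono sol_lip[OF Y] L_nonneg)
    finally show ?thesis by (simp add: algebra_simps)
  qed
  moreover have "continuous_on UNIV (\<lambda>p. f (fst p) (snd p))"
  proof (rule lipschitz2_continuous)
    fix x y x' y' :: real
    have "L * (\<bar>of_int k\<bar> + M) * \<bar>y - y'\<bar> \<le> L * (\<bar>of_int k\<bar> + M) * (\<bar>x - x'\<bar> + \<bar>y - y'\<bar>)"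
      using L_nonneg M_nonneg by (intro mult_left_mono) auto
    then show "\<bar>f x y - f x' y'\<bar> \<le> L * (\<bar>of_int k\<bar> + M) * (\<bar>x - x'\<bar> + \<bar>y - y'\<bar>)"
      using *[of x y y'] by (simp add: f_def)
  qed
  moreover have "\<bar>f t s\<bar> \<le> m'" for t s
    using phi_pos phi_hi by (simp add: f_def less_imp_le)
  ultimately have "\<exists>\<sigma>. \<sigma> 0 = s0 \<and> (\<forall>t. (\<sigma> has_real_derivative f t (\<sigma> t)) (at t))"
    by (rule picard_lindelof)
  then show ?thesis unfolding clock_def f_def by blast
qed

lemma clock_speed:
  assumes "clock xb k Y \<sigma>" "t \<le> t'"
  shows "m * (t' - t) \<le> \<sigma> t' - \<sigma> t" and "\<sigma> t' - \<sigma> t \<le> m' * (t' - t)"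
proof -
  \<comment> \<open>The speed is within \<open>(m' - m) / 2\<close> of the midpoint of
    \<open>m\<close> and \<open>m'\<close>, so one estimate yields both inequalities.\<close>
  have "\<bar>\<sigma> t' - \<sigma> t - (m + m') / 2 * (t' - t)\<bar> \<le> (m' - m) / 2 * (t' - t)"
  proof (rule real_deriv_bound[OF assms(2)])
    show "(\<sigma> has_real_derivative \<phi> k (of_int k * (xb - \<sigma> t)) (Y (\<sigma> t))) (at t)" for t
      using assms(1) by (simp add: clock_def)
    show "\<bar>\<phi> k (of_int k * (xb - \<sigma> t)) (Y (\<sigma> t)) - (m + m') / 2\<bar> \<le> (m' - m) / 2" for t
      using phi_lo[of k "of_int k * (xb - \<sigma> t)" "Y (\<sigma> t)"]
        phi_hi[of k "of_int k * (xb - \<sigma> t)" "Y (\<sigma> t)"] by (auto simp: abs_le_iff field_simps)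
  qed
  then show "m * (t' - t) \<le> \<sigma> t' - \<sigma> t" and "\<sigma> t' - \<sigma> t \<le> m' * (t' - t)"
    by (auto simp: abs_le_iff field_simps)
qed

lemma clock_strict_mono: "clock xb k Y \<sigma> \<Longrightarrow> strict_mono \<sigma>"
proof (rule strict_monoI)
  fix t t' :: real assume "clock xb k Y \<sigma>" "t < t'"
  then show "\<sigma> t < \<sigma> t'"
    using clock_speed(1)[of xb k Y \<sigma> t t'] mult_pos_pos[OF m_pos, of "t' - t"] by simp
qed

lemma clock_reaches:
  assumes c: "clock xb k Y \<sigma>" and s: "\<sigma> a \<le> s"
  shows "\<exists>t\<ge>a. \<sigma> t = s"
proof -
  \<comment> \<open>By this time even the least speed \<open>m\<close> has covered the distance
    \<open>s - \<sigma> a\<close>.\<close>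
  define b where "b = a + (s - \<sigma> a) / m"
  have ab: "a \<le> b" using s m_pos by (simp add: b_def)
  have "s \<le> \<sigma> b" using clock_speed(1)[OF c ab] m_pos by (simp add: b_def)
  moreover have "continuous_on {a..b} \<sigma>"
    using c unfolding clock_def by (meson DERIV_isCont continuous_at_imp_continuous_on)
  ultimately show ?thesis using IVT'[of \<sigma> a s b] s ab by blast
qed

section \<open>Half maps and the fixed point of the return map\<close>

definition graph :: "real \<Rightarrow> int \<Rightarrow> real \<Rightarrow> real \<Rightarrow> real" where
  "graph xb k y = (SOME Y. sol xb k Y \<and> Y 0 = y)"

lemma graph: "sol xb k (graph xb k y)" "graph xb k y 0 = y"
  using someI_ex[OF sol_exists[of xb k 0 y]] by (auto simp: graph_def)

definition half_map :: "real \<Rightarrow> int \<Rightarrow> real \<Rightarrow> real" where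
  "half_map xb k y = graph xb k y (2 * xb)"

lemma graph_bound: "\<bar>graph xb k y s\<bar> \<le> \<bar>y\<bar> + M * \<bar>s\<bar>"
  using sol_lip[OF graph(1), of xb k y s 0] graph(2)[of xb k y] by simp

text \<open>During the crossing \<open>x\<close> is at most \<open>xb\<close> and the graph at most
  \<open>\<bar>y\<bar> + 2 * M * xb\<close> in absolute value, so the slope differs from its value
  at the origin by at most \<open>L\<close> times their sum.\<close>

lemma half_map_approx:
  assumes k: "k \<in> {-1, 1}" and xb: "xb > 0"
  shows "\<bar>half_map xb k y - y - 2 * xb * h k 0 0\<bar> \<le> 2 * xb * (L * (xb + \<bar>y\<bar> + 2 * M * xb))"
proof -
  have "\<bar>graph xb k y (2 * xb) - graph xb k y 0 - h k 0 0 * (2 * xb - 0)\<bar>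
    \<le> L * (xb + \<bar>y\<bar> + 2 * M * xb) * (2 * xb - 0)"
  proof (rule real_deriv_bound)
    show "(graph xb k y has_real_derivative h k (of_int k * (xb - s)) (graph xb k y s)) (at s)" for s
      using graph(1) by (simp add: sol_def)
    fix s assume s: "0 \<le> s" "s \<le> 2 * xb"
    have "\<bar>of_int k * (xb - s)\<bar> = \<bar>xb - s\<bar>" using k by auto
    then have "\<bar>of_int k * (xb - s)\<bar> \<le> xb" using s by (auto simp: abs_le_iff)
    moreover have "\<bar>graph xb k y s\<bar> \<le> \<bar>y\<bar> + 2 * M * xb"
      using graph_bound[of xb k y s] mult_left_mono[OF s(2) M_nonneg] s by simp
    ultimately have "\<bar>of_int k * (xb - s) - 0\<bar> + \<bar>graph xb k y s - 0\<bar> \<le> xb + \<bar>y\<bar> + 2 * M * xb" by simp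
    then show "\<bar>h k (of_int k * (xb - s)) (graph xb k y s) - h k 0 0\<bar> \<le> L * (xb + \<bar>y\<bar> + 2 * M * xb)"
      using h_lip mult_left_mono L_nonneg order_trans by meson
  qed (use xb in simp)
  then show ?thesis using graph(2) by (simp add: half_map_def mult_ac)
qed

text \<open>Dominates \<open>- (\<alpha> 1 + \<alpha> (-1))\<close> as well as the differences
  between \<open>\<alpha> 1\<close> and \<open>\<alpha> (-1)\<close>.\<close>

definition "A = \<bar>\<alpha> 1\<bar> + \<bar>\<alpha> (-1)\<bar>"
text \<open>The return map displaces \<open>0\<close> by at most
  \<open>L * (4 + 12 * M) * xb\<^sup>2\<close>, while its contraction factor is at most
  \<open>1 + xb * (\<alpha> 1 + \<alpha> (-1))\<close>. The quotient of displacement and defect is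
  \<open>M1 * xb\<close>.\<close>

definition "M1 = L * (4 + 12 * M) / - (\<alpha> 1 + \<alpha> (-1))"

lemma M1_nonneg: "0 \<le> M1"
  unfolding M1_def by (rule divide_nonneg_pos) (use L_nonneg M_nonneg alpha in auto)

text \<open>The factor \<open>8\<close> leaves room for a deviation of \<open>r / 2\<close> from the
  cycle: its ordinates, at most \<open>M1 * xb + 2 * (M * xb)\<close>, and the drift
  \<open>2 * (M * xb)\<close> of one crossing together use up at most the other half of
  \<open>r\<close>. The bound on \<open>A * xb\<close> is what the estimates of exponentials
  need.\<close>

definition small :: "real \<Rightarrow> bool" where
  "small xb \<longleftrightarrow> 0 < xb \<and> 8 * ((1 + M + M1) * xb) \<le> r \<and> A * xb \<le> 1 / 2"

lemma smallD:
  assumes "small xb"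
  shows "0 < xb" "8 * xb + 8 * (M * xb) + 8 * (M1 * xb) \<le> r" "A * xb \<le> 1 / 2"
    "0 \<le> M * xb" "0 \<le> M1 * xb" "xb \<le> r"
  using assms M_nonneg M1_nonneg
  by (auto simp: small_def algebra_simps) (smt (verit) mult_nonneg_nonneg)+

lemma half_map_contract:
  assumes k: "k \<in> {-1, 1}" and xb: "small xb" and y: "\<bar>y\<bar> + 2 * (M * xb) \<le> r" and y': "\<bar>y'\<bar> + 2 * (M * xb) \<le> r"
  shows "\<bar>half_map xb k y - half_map xb k y'\<bar> \<le> exp (2 * xb * \<alpha> k) * \<bar>y - y'\<bar>"
proof -
  have b: "\<bar>graph xb k z s\<bar> \<le> r" if "\<bar>z\<bar> + 2 * (M * xb) \<le> r" "0 \<le> s" "s \<le> 2 * xb" for z s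
    using graph_bound[of xb k z s] mult_left_mono[OF that(3) M_nonneg] that by simp
  have "\<bar>graph xb k y (2 * xb) - graph xb k y' (2 * xb)\<bar>
      \<le> exp (\<alpha> k * (2 * xb - 0)) * \<bar>graph xb k y 0 - graph xb k y' 0\<bar>"
    by (rule sol_contract[OF k graph(1) graph(1)])
      (use smallD[OF xb] b y y' in \<open>auto simp: abs_le_iff\<close>)
  then show ?thesis by (simp add: half_map_def graph mult_ac)
qed

lemma cycle_exists:
  assumes xb: "small xb"
  shows "\<exists>y. \<bar>y\<bar> \<le> M1 * xb \<and> half_map xb (-1) (half_map xb 1 y) = y"
proof -
  note sm = smallD[OF xb]
  define P where "P y = half_map xb (-1) (half_map xb 1 y)" for y
  define c where "c = exp (2 * xb * (\<alpha> 1 + \<alpha> (-1)))"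
  have c1: "c < 1" using sm(1) alpha by (simp add: c_def mult_pos_neg)
  have half: "\<bar>half_map xb k y\<bar> \<le> \<bar>y\<bar> + 2 * (M * xb)" for k y
    using graph_bound[of xb k y "2 * xb"] sm(1) by (simp add: half_map_def)
  have con: "\<bar>P y - P y'\<bar> \<le> c * \<bar>y - y'\<bar>" if "\<bar>y\<bar> \<le> M1 * xb" "\<bar>y'\<bar> \<le> M1 * xb" for y y'
  proof -
    have "\<bar>P y - P y'\<bar> \<le> exp (2 * xb * \<alpha> (-1)) * \<bar>half_map xb 1 y - half_map xb 1 y'\<bar>"
      unfolding P_def by (rule half_map_contract) (use that half[of 1 y] half[of 1 y'] sm xb in auto)
    also have "\<dots> \<le> exp (2 * xb * \<alpha> (-1)) * (exp (2 * xb * \<alpha> 1) * \<bar>y - y'\<bar>)"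
      by (intro mult_left_mono half_map_contract) (use that sm xb in auto)
    also have "\<dots> = c * \<bar>y - y'\<bar>"
      by (simp add: c_def distrib_left exp_add mult_ac)
    finally show ?thesis .
  qed
  \<comment> \<open>\<open>balance\<close> cancels the first order terms of the two half maps. The
    remainders contribute \<open>2 + 8 * M\<close> and \<open>2 + 4 * M\<close> times
    \<open>L * xb\<^sup>2\<close>; the first is larger because the second crossing starts away from
    \<open>0\<close>.\<close>
  have P0: "\<bar>P 0\<bar> \<le> L * (4 + 12 * M) * xb\<^sup>2"
  proof -
    have "\<bar>half_map xb (-1) (half_map xb 1 0) - half_map xb 1 0 - 2 * xb * h (-1) 0 0\<bar>
      \<le> 2 * xb * (L * (xb + \<bar>half_map xb 1 0\<bar> + 2 * M * xb))"
      by (rule half_map_approx) (use sm in auto)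
    also have "\<dots> \<le> 2 * xb * (L * (xb + 2 * (M * xb) + 2 * M * xb))"
      by (intro mult_left_mono add_right_mono add_left_mono) (use half[of 1 0] sm L_nonneg in auto)
    finally have 1: "\<bar>P 0 - half_map xb 1 0 - 2 * xb * h (-1) 0 0\<bar> \<le> \<dots>" by (simp add: P_def)
    have 2: "\<bar>half_map xb 1 0 - 0 - 2 * xb * h 1 0 0\<bar> \<le> 2 * xb * (L * (xb + \<bar>0\<bar> + 2 * M * xb))"
      by (rule half_map_approx) (use sm in auto)
    have "h (-1) 0 0 = - h 1 0 0" using balance by simp
    then have "\<bar>P 0\<bar> \<le> 2 * xb * (L * (xb + 2 * (M * xb) + 2 * M * xb)) + 2 * xb * (L * (xb + 2 * M * xb))"
      using 1 2 by (simp add: abs_le_iff)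
    then show ?thesis by (simp add: algebra_simps power2_eq_square)
  qed
  have inv: "\<bar>P y\<bar> \<le> M1 * xb" if y: "\<bar>y\<bar> \<le> M1 * xb" for y
  proof -
    have "- (\<alpha> 1 + \<alpha> (-1)) * xb \<le> A * xb" by (rule mult_right_mono) (use sm in \<open>auto simp: A_def\<close>)
    moreover have "2 * xb * (\<alpha> 1 + \<alpha> (-1)) \<le> 0" using alpha sm by (simp add: mult_le_0_iff)
    ultimately have "exp (- (- (2 * xb * (\<alpha> 1 + \<alpha> (-1))))) \<le> 1 - (- (2 * xb * (\<alpha> 1 + \<alpha> (-1)))) / 2"
      using sm(3) by (intro exp_neg_le) (simp_all add: algebra_simps)
    then have c: "c \<le> 1 + xb * (\<alpha> 1 + \<alpha> (-1))" by (simp add: c_def)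
    have "\<bar>P y\<bar> \<le> c * \<bar>y - 0\<bar> + \<bar>P 0\<bar>" using con[OF y, of 0] sm by simp
    also have "\<dots> \<le> (1 + xb * (\<alpha> 1 + \<alpha> (-1))) * (M1 * xb) + L * (4 + 12 * M) * xb\<^sup>2"
      by (intro add_mono mult_mono P0 c) (use y c in \<open>auto simp: c_def intro: order_trans[OF exp_ge_zero]\<close>)
    \<comment> \<open>With this value of \<open>M1\<close> the two terms of order
      \<open>xb\<^sup>2\<close> cancel exactly, so the interval is mapped into itself.\<close>
    also have "L * (4 + 12 * M) = M1 * - (\<alpha> 1 + \<alpha> (-1))"
      using alpha by (simp add: M1_def)
    finally show ?thesis by (simp add: algebra_simps power2_eq_square)
  qed
  have "\<exists>!y\<in>{- (M1 * xb)..M1 * xb}. P y = y"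
  proof (rule Banach_fix[of _ c])
    show "P ` {- (M1 * xb)..M1 * xb} \<subseteq> {- (M1 * xb)..M1 * xb}"
    proof (rule image_subsetI)
      fix y assume "y \<in> {- (M1 * xb)..M1 * xb}"
      then show "P y \<in> {- (M1 * xb)..M1 * xb}" using inv[of y] by (simp add: abs_le_iff)
    qed
    fix x y assume "x \<in> {- (M1 * xb)..M1 * xb}" "y \<in> {- (M1 * xb)..M1 * xb}"
    then show "dist (P x) (P y) \<le> c * dist x y"
      using con[of x y] by (simp add: dist_real_def abs_le_iff)
  next
    show "{- (M1 * xb)..M1 * xb} \<noteq> {}" using sm by simp
  qed (use c1 sm in \<open>auto simp: c_def complete_eq_closed\<close>)
  then obtain y where "y \<in> {- (M1 * xb)..M1 * xb}" "P y = y" by blast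
  then show ?thesis unfolding P_def by (intro exI[of _ y]) (simp add: abs_le_iff)
qed

end

text \<open>\<open>c k\<close> is the ordinate at which the cycle begins its crossing with index
  \<open>k\<close>. Recording the fixed point together with its image treats both indices alike; the
  image accounts for the summand \<open>2 * M\<close> in the bound.\<close>

locale hysteresis_cycle = hysteresis +
  fixes xb :: real and c :: "int \<Rightarrow> real"
  assumes small_xb: "small xb"
    and c_bd: "\<And>k. k \<in> {-1, 1} \<Longrightarrow> \<bar>c k\<bar> \<le> (M1 + 2 * M) * xb"
    and c_map: "\<And>k. k \<in> {-1, 1} \<Longrightarrow> half_map xb k (c k) = c (- k)"
begin

section \<open>Trajectories near the cycle as sequences of crossings\<close>

lemmas sm = smallD[OF small_xb]

definition pt :: "int \<Rightarrow> real \<Rightarrow> real \<Rightarrow> state" where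
  "pt k y s = ((of_int k * (xb - s), graph xb k y s), k)"

text \<open>\<open>t\<close> lists the switching times, \<open>\<kappa>\<close> the indices and
  \<open>\<sigma>\<close> the clocks in absolute time. The value \<open>\<sigma> 0 0\<close> is left
  free, so that a trajectory may start anywhere on its first graph; \<open>y 0\<close> is then the
  ordinate of that graph extended to \<open>s = 0\<close>.\<close>

definition unrolled :: "(real \<Rightarrow> state) \<Rightarrow> (nat \<Rightarrow> real) \<Rightarrow> (nat \<Rightarrow> int) \<Rightarrow> (nat \<Rightarrow> real)
    \<Rightarrow> (nat \<Rightarrow> real \<Rightarrow> real) \<Rightarrow> bool" where
  "unrolled v t \<kappa> y \<sigma> \<longleftrightarrow> trajectory F xb v \<and> t 0 = 0 \<and> (\<forall>n. t n < t (Suc n)) \<and> (\<forall>\<tau>. \<exists>n. \<tau> < t n)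
    \<and> (\<forall>n. \<kappa> n \<in> {-1, 1}) \<and> (\<forall>n. \<kappa> (Suc n) = - \<kappa> n)
    \<and> (\<forall>n. clock xb (\<kappa> n) (graph xb (\<kappa> n) (y n)) (\<sigma> n))
    \<and> (\<forall>n. \<sigma> (Suc n) (t (Suc n)) = 0) \<and> (\<forall>n. \<sigma> n (t (Suc n)) = 2 * xb)
    \<and> (\<forall>n u. t n \<le> u \<and> u < t (Suc n) \<longrightarrow> v u = pt (\<kappa> n) (y n) (\<sigma> n u))"

text \<open>The geometric mean of the two half map factors
  \<open>exp (2 * xb * \<alpha> k)\<close>.\<close>

definition "\<rho> = exp (xb * (\<alpha> 1 + \<alpha> (-1)))"

lemma rho: "0 < \<rho>" "\<rho> < 1"
  using sm(1) alpha by (auto simp: \<rho>_def mult_pos_neg)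

lemma graph_box:
  assumes "k \<in> {-1, 1}" "\<bar>y - c k\<bar> \<le> r / 2" "- xb \<le> s" "s \<le> 2 * xb"
  shows "\<bar>graph xb k y s\<bar> \<le> r"
proof -
  have "M * \<bar>s\<bar> \<le> M * (2 * xb)" by (rule mult_left_mono) (use assms sm M_nonneg in auto)
  then have "\<bar>graph xb k y s\<bar> \<le> \<bar>y\<bar> + 2 * (M * xb)" using graph_bound[of xb k y s] by simp
  moreover have "\<bar>c k\<bar> \<le> M1 * xb + 2 * (M * xb)" using c_bd[OF assms(1)] by (simp add: algebra_simps)
  ultimately show ?thesis using assms(2) sm by linarith
qed

text \<open>The weights \<open>exp (xb * \<alpha> k)\<close> turn both half maps into contractions with the same
  factor, although \<open>\<alpha> k\<close> may be positive for one of the two indices.\<close>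

lemma half_map_decay:
  assumes k: "\<And>n. \<kappa> n \<in> {-1, 1}" "\<And>n. \<kappa> (Suc n) = - \<kappa> n"
    and y: "\<And>n. y (Suc n) = half_map xb (\<kappa> n) (y n)"
    and y0: "\<bar>y 0 - c (\<kappa> 0)\<bar> \<le> r / 4"
  shows "\<bar>y n - c (\<kappa> n)\<bar> \<le> 2 * \<rho> ^ n * \<bar>y 0 - c (\<kappa> 0)\<bar>"
proof -
  define D where "D n = exp (xb * \<alpha> (\<kappa> n)) * \<bar>y n - c (\<kappa> n)\<bar>" for n
  \<comment> \<open>The factor \<open>2\<close> is the price of removing the weights: their quotient
    is at most \<open>exp (A * xb)\<close>, hence at most \<open>exp (1 / 2)\<close>.\<close>
  have unweight: "\<bar>y n - c (\<kappa> n)\<bar> \<le> 2 * \<rho> ^ n * \<bar>y 0 - c (\<kappa> 0)\<bar>" if "D n \<le> \<rho> ^ n * D 0" for n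
  proof -
    have "exp (- (xb * \<alpha> (\<kappa> n))) * D n \<le> exp (- (xb * \<alpha> (\<kappa> n))) * (\<rho> ^ n * D 0)"
      using that by (intro mult_left_mono) auto
    then have "\<bar>y n - c (\<kappa> n)\<bar>
        \<le> exp (- (xb * \<alpha> (\<kappa> n)) + xb * \<alpha> (\<kappa> 0)) * (\<rho> ^ n * \<bar>y 0 - c (\<kappa> 0)\<bar>)"
      unfolding exp_add D_def
      by (simp add: mult.assoc[symmetric] exp_add[symmetric]) (simp add: exp_diff exp_minus field_simps)
    also have "\<dots> \<le> 2 * (\<rho> ^ n * \<bar>y 0 - c (\<kappa> 0)\<bar>)"
    proof (rule mult_right_mono)
      have "\<alpha> (\<kappa> 0) - \<alpha> (\<kappa> n) \<le> A" using k(1)[of 0] k(1)[of n] by (auto simp: A_def)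
      then have "xb * (\<alpha> (\<kappa> 0) - \<alpha> (\<kappa> n)) \<le> xb * A" using sm by (intro mult_left_mono) auto
      then have "exp (- (xb * \<alpha> (\<kappa> n)) + xb * \<alpha> (\<kappa> 0)) \<le> exp (1 / 2)"
        using sm(3) by (simp add: algebra_simps)
      then show "exp (- (xb * \<alpha> (\<kappa> n)) + xb * \<alpha> (\<kappa> 0)) \<le> 2" using exp_half_le2 by linarith
    qed (use rho in auto)
    finally show ?thesis by simp
  qed
  have "D n \<le> \<rho> ^ n * D 0"
  proof (induction n)
    case (Suc n)
    \<comment> \<open>\<open>half_map_contract\<close> is available only in the box. The unweighted
      bound at stage \<open>n\<close> places \<open>y n\<close> within \<open>r / 2\<close> of the
      cycle, and hence there.\<close>
    have "2 * \<rho> ^ n * \<bar>y 0 - c (\<kappa> 0)\<bar> \<le> 2 * 1 * \<bar>y 0 - c (\<kappa> 0)\<bar>"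
      using rho by (intro mult_right_mono mult_left_mono power_le_one) auto
    with unweight[OF Suc] have "\<bar>y n - c (\<kappa> n)\<bar> \<le> 2 * 1 * \<bar>y 0 - c (\<kappa> 0)\<bar>" by (rule order_trans)
    then have "\<bar>y n - c (\<kappa> n)\<bar> \<le> r / 2" using y0 by simp
    moreover have cb: "\<bar>c (\<kappa> n)\<bar> \<le> M1 * xb + 2 * (M * xb)"
      using c_bd[OF k(1)[of n]] by (simp add: algebra_simps)
    ultimately have "\<bar>half_map xb (\<kappa> n) (y n) - half_map xb (\<kappa> n) (c (\<kappa> n))\<bar>
        \<le> exp (2 * xb * \<alpha> (\<kappa> n)) * \<bar>y n - c (\<kappa> n)\<bar>"
      using sm by (intro half_map_contract k small_xb) linarith+
    then have "\<bar>y (Suc n) - c (\<kappa> (Suc n))\<bar> \<le> exp (2 * xb * \<alpha> (\<kappa> n)) * \<bar>y n - c (\<kappa> n)\<bar>"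
      by (simp add: y k(2) c_map[OF k(1)])
    then have "D (Suc n) \<le> exp (xb * \<alpha> (\<kappa> (Suc n))) * (exp (2 * xb * \<alpha> (\<kappa> n)) * \<bar>y n - c (\<kappa> n)\<bar>)"
      unfolding D_def by (intro mult_left_mono) auto
    also have "\<dots> = exp (xb * \<alpha> (- \<kappa> n) + 2 * xb * \<alpha> (\<kappa> n)) * \<bar>y n - c (\<kappa> n)\<bar>"
      by (simp only: exp_add k(2) mult.assoc)
    \<comment> \<open>The reason for the weights: the new weight times the half map factor is
      \<open>\<rho>\<close> times the old weight, whatever the index.\<close>
    also have "xb * \<alpha> (- \<kappa> n) + 2 * xb * \<alpha> (\<kappa> n)
        = xb * (\<alpha> (- \<kappa> n) + \<alpha> (\<kappa> n)) + xb * \<alpha> (\<kappa> n)"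
      by (simp add: algebra_simps)
    also have "exp \<dots> * \<bar>y n - c (\<kappa> n)\<bar> = exp (xb * (\<alpha> (- \<kappa> n) + \<alpha> (\<kappa> n))) * D n"
      by (simp only: exp_add D_def mult.assoc)
    also have "xb * (\<alpha> (- \<kappa> n) + \<alpha> (\<kappa> n)) = xb * (\<alpha> 1 + \<alpha> (-1))" using k(1)[of n] by auto
    finally have "D (Suc n) \<le> \<rho> * D n" by (simp add: \<rho>_def)
    also have "\<dots> \<le> \<rho> * (\<rho> ^ n * D 0)" using Suc rho by (intro mult_left_mono) auto
    finally show ?case by (simp add: mult.assoc)
  qed simp
  then show ?thesis by (rule unweight)
qed

text \<open>A value \<open>s0 < 0\<close> describes a state beyond the line of its own index; it
  crosses that line without a change of index before the proper crossing begins.\<close>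

lemma unroll:
  assumes k: "k \<in> {-1, 1}" and s0: "- xb \<le> s0" "s0 < 2 * xb" and y0: "\<bar>y0 - c k\<bar> \<le> r / 4"
  shows "\<exists>v t \<kappa> y \<sigma>. unrolled v t \<kappa> y \<sigma> \<and> \<kappa> 0 = k \<and> y 0 = y0 \<and> \<sigma> 0 0 = s0
    \<and> (\<forall>n. \<bar>y n - c (\<kappa> n)\<bar> \<le> 2 * \<rho> ^ n * \<bar>y0 - c k\<bar>)"
proof -
  define st where "st n = ((\<lambda>(k, y). (- k, half_map xb k y)) ^^ n) (k, y0)" for n
  define \<kappa> y where "\<kappa> n = fst (st n)" and "y n = snd (st n)" for n
  have \<kappa>0: "\<kappa> 0 = k" and y_0: "y 0 = y0" by (simp_all add: \<kappa>_def y_def st_def)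
  have \<kappa>S: "\<kappa> (Suc n) = - \<kappa> n" and yS: "y (Suc n) = half_map xb (\<kappa> n) (y n)" for n
    by (simp_all add: \<kappa>_def y_def st_def case_prod_beta)
  have \<kappa>: "\<kappa> n \<in> {-1, 1}" for n by (induction n) (use k \<kappa>0 \<kappa>S in auto)
  have decay: "\<bar>y n - c (\<kappa> n)\<bar> \<le> 2 * \<rho> ^ n * \<bar>y0 - c k\<bar>" for n
    using half_map_decay[of \<kappa> y n] \<kappa> \<kappa>S yS y0 \<kappa>0 y_0 by simp
  have close: "\<bar>y n - c (\<kappa> n)\<bar> \<le> r / 2" for n
  proof -
    have "2 * \<rho> ^ n * \<bar>y0 - c k\<bar> \<le> 2 * 1 * \<bar>y0 - c k\<bar>"
      using rho by (intro mult_right_mono mult_left_mono power_le_one) auto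
    with decay[of n] have "\<bar>y n - c (\<kappa> n)\<bar> \<le> 2 * 1 * \<bar>y0 - c k\<bar>" by (rule order_trans)
    then show ?thesis using y0 by simp
  qed
  \<comment> \<open>Only the first piece may start away from \<open>s = 0\<close>.\<close>
  define s where "s n = (if n = 0 then s0 else 0)" for n :: nat
  have s: "- xb \<le> s n" "s n < 2 * xb" "s n \<le> max s0 0" for n using s0 sm(1) by (auto simp: s_def)
  have "\<exists>\<sigma>. clock xb (\<kappa> n) (graph xb (\<kappa> n) (y n)) \<sigma> \<and> \<sigma> 0 = s n" for n
    by (rule clock_exists[OF graph(1)])
  then obtain cl where cl: "\<And>n. clock xb (\<kappa> n) (graph xb (\<kappa> n) (y n)) (cl n)" "\<And>n. cl n 0 = s n"
    by metis
  have "\<exists>t\<ge>0. cl n t = 2 * xb" for n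
    by (rule clock_reaches[OF cl(1)]) (use cl(2) s[of n] in simp)
  then obtain \<tau> where \<tau>: "\<And>n. \<tau> n \<ge> 0" "\<And>n. cl n (\<tau> n) = 2 * xb" by metis
  \<comment> \<open>Each piece covers at least \<open>2 * xb - max s0 0\<close> at speed at most
    \<open>m'\<close>. This common lower bound on the durations makes the switching times
    unbounded.\<close>
  define d where "d = (2 * xb - max s0 0) / m'"
  have d: "d > 0" using s0 sm(1) m'_pos by (simp add: d_def)
  have \<tau>d: "d \<le> \<tau> n" for n
  proof -
    have "2 * xb - s n \<le> m' * \<tau> n" using clock_speed(2)[OF cl(1)[of n] \<tau>(1)[of n]] cl(2) \<tau>(2) by simp
    then have "2 * xb - max s0 0 \<le> m' * \<tau> n" using s(3)[of n] by linarith
    then show ?thesis using m'_pos by (simp add: d_def divide_le_eq mult.commute)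
  qed
  define t where "t n = (\<Sum>i<n. \<tau> i)" for n
  have tS: "t (Suc n) = t n + \<tau> n" for n by (simp add: t_def)
  have t_lt: "t n < t (Suc n)" for n using tS \<tau>d[of n] d by simp
  have unb: "\<exists>n. x < t n" for x
  proof -
    obtain n where "x < real n * d" using reals_Archimedean3[OF d] by blast
    moreover have "real n * d \<le> t n"
      using sum_mono[of "{..<n}" "\<lambda>_. d" \<tau>] \<tau>d by (simp add: t_def)
    ultimately show ?thesis by (intro exI[of _ n]) simp
  qed
  define \<sigma> where "\<sigma> n u = cl n (u - t n)" for n u
  have \<sigma>: "clock xb (\<kappa> n) (graph xb (\<kappa> n) (y n)) (\<sigma> n)" for n
    unfolding clock_def
  proof
    fix u
    have "(cl n has_real_derivative
        \<phi> (\<kappa> n) (of_int (\<kappa> n) * (xb - \<sigma> n u)) (graph xb (\<kappa> n) (y n) (\<sigma> n u))) (at (u + - t n))"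
      using cl(1)[of n] by (simp add: clock_def \<sigma>_def)
    then show "(\<sigma> n has_real_derivative
        \<phi> (\<kappa> n) (of_int (\<kappa> n) * (xb - \<sigma> n u)) (graph xb (\<kappa> n) (y n) (\<sigma> n u))) (at u)"
      unfolding DERIV_shift by (simp add: \<sigma>_def[abs_def])
  qed
  have \<sigma>l: "\<sigma> n (t n) = s n" and \<sigma>r: "\<sigma> n (t (Suc n)) = 2 * xb" for n
    by (simp_all add: \<sigma>_def cl(2) tS \<tau>(2))
  note mono = clock_strict_mono[OF \<sigma>]
  have \<sigma>b: "- xb \<le> \<sigma> n u" "\<sigma> n u \<le> 2 * xb" if "t n \<le> u" "u \<le> t (Suc n)" for n u
  proof -
    have "\<sigma> n (t n) \<le> \<sigma> n u" "\<sigma> n u \<le> \<sigma> n (t (Suc n))"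
      using that strict_mono_less_eq[OF mono] by blast+
    then show "- xb \<le> \<sigma> n u" "\<sigma> n u \<le> 2 * xb" using \<sigma>l \<sigma>r s(1)[of n] by auto
  qed
  define p where "p n u = (of_int (\<kappa> n) * (xb - \<sigma> n u), graph xb (\<kappa> n) (y n) (\<sigma> n u))" for n u
  have F: "F (\<kappa> n) (p n u) = (- of_int (\<kappa> n) * \<phi> (\<kappa> n) (fst (p n u)) (snd (p n u)),
      h (\<kappa> n) (fst (p n u)) (snd (p n u)) * \<phi> (\<kappa> n) (fst (p n u)) (snd (p n u)))"
    if u: "t n \<le> u" "u \<le> t (Suc n)" for n u
  proof -
    have "\<bar>graph xb (\<kappa> n) (y n) (\<sigma> n u)\<bar> \<le> r" by (rule graph_box[OF \<kappa> close \<sigma>b[OF u]])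
    moreover have "\<bar>of_int (\<kappa> n) * (xb - \<sigma> n u)\<bar> \<le> r"
      using \<kappa>[of n] \<sigma>b[OF u] sm by auto
    ultimately show ?thesis unfolding p_def by (simp add: field[OF \<kappa>])
  qed
  have "\<exists>v. trajectory F xb v \<and> (\<forall>n u. t n \<le> u \<and> u < t (Suc n) \<longrightarrow> v u = (p n u, \<kappa> n))"
  proof (rule trajectory_concat)
    fix n u assume u: "t n \<le> u" "u \<le> t (Suc n)"
    have d\<sigma>: "(\<sigma> n has_real_derivative \<phi> (\<kappa> n) (fst (p n u)) (snd (p n u))) (at u)"
      using \<sigma>[of n] by (simp add: clock_def p_def)
    have "((\<lambda>u. graph xb (\<kappa> n) (y n) (\<sigma> n u)) has_real_derivative
        h (\<kappa> n) (fst (p n u)) (snd (p n u)) * \<phi> (\<kappa> n) (fst (p n u)) (snd (p n u))) (at u)"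
      by (rule DERIV_chain2[OF _ d\<sigma>]) (use graph(1)[of xb "\<kappa> n" "y n"] in \<open>simp add: sol_def p_def\<close>)
    moreover have "((\<lambda>u. of_int (\<kappa> n) * (xb - \<sigma> n u)) has_real_derivative
        - of_int (\<kappa> n) * \<phi> (\<kappa> n) (fst (p n u)) (snd (p n u))) (at u)"
      by (auto intro!: derivative_eq_intros d\<sigma>)
    ultimately show "(p n has_vector_derivative F (\<kappa> n) (p n u)) (at u)"
      unfolding F[OF u] unfolding p_def has_real_derivative_iff_has_vector_derivative
      by (intro has_vector_derivative_Pair)
    show "fst (F (\<kappa> n) (p n u)) \<noteq> 0"
      unfolding F[OF u] using \<kappa>[of n] phi_pos[of "\<kappa> n" "fst (p n u)" "snd (p n u)"] by auto
  next
    fix n u assume u: "t n \<le> u" "u < t (Suc n)"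
    have "\<sigma> n u < 2 * xb" using strict_monoD[OF mono[of n] u(2)] \<sigma>r[of n] by simp
    then show "valid_state xb (p n u, \<kappa> n)"
      unfolding valid_state_iff[OF sm(1)] p_def using \<kappa>[of n] by auto
  next
    fix n
    show "p n (t (Suc n)) = p (Suc n) (t (Suc n))"
      by (simp add: p_def \<sigma>r \<sigma>l s_def \<kappa>S yS graph(2)) (simp add: half_map_def)
    show "fst (p n (t (Suc n))) \<in> {xb, - xb}" using \<kappa>[of n] by (auto simp: p_def \<sigma>r)
    \<comment> \<open>The lines are \<open>s = 0\<close> and \<open>s = 2 * xb\<close>, and the
      clock is injective, so a piece meets each of them at most once.\<close>
    have "{u \<in> {t n..t (Suc n)}. fst (p n u) \<in> {xb, - xb}} \<subseteq> \<sigma> n -` {0, 2 * xb}"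
      using \<kappa>[of n] by (auto simp: p_def)
    moreover have "finite (\<sigma> n -` {0, 2 * xb})"
      using strict_mono_imp_inj_on[OF mono] by (intro finite_vimageI) auto
    ultimately show "finite {u \<in> {t n..t (Suc n)}. fst (p n u) \<in> {xb, - xb}}" by (rule finite_subset)
  qed (use unb t_lt in \<open>auto simp: t_def\<close>)
  then obtain v where v: "trajectory F xb v"
    "\<And>n u. t n \<le> u \<Longrightarrow> u < t (Suc n) \<Longrightarrow> v u = pt (\<kappa> n) (y n) (\<sigma> n u)"
    by (auto simp: pt_def p_def)
  have "t 0 = 0" by (simp add: t_def)
  then have "unrolled v t \<kappa> y \<sigma>"
    unfolding unrolled_def using v t_lt unb \<kappa> \<kappa>S \<sigma> \<sigma>r \<sigma>l[of "Suc _"] by (simp add: s_def)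
  moreover have "\<sigma> 0 0 = s0" using \<sigma>l[of 0] by (simp add: s_def t_def)
  ultimately show ?thesis using decay \<kappa>0 y_0 by blast
qed

end

section \<open>The limit cycle\<close>

lemma state_dist_le:
  assumes "p \<in> C" "snd p = snd s"
  shows "state_dist s C \<le> \<bar>fst (fst s) - fst (fst p)\<bar> + \<bar>snd (fst s) - snd (fst p)\<bar>"
proof -
  have "state_dist s C \<le> dist (embed_state s) (embed_state p)"
    unfolding state_dist_def by (rule infdist_le) (use assms in auto)
  also have "\<dots> = dist (fst s) (fst p)" by (simp add: embed_state_def assms(2) dist_Pair_Pair)
  also have "\<dots> \<le> \<bar>fst (fst s) - fst (fst p)\<bar> + \<bar>snd (fst s) - snd (fst p)\<bar>"
    unfolding dist_prod_def dist_real_def using sqrt_sum_squares_le_sum_abs by fastforce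
  finally show ?thesis .
qed

lemma state_dist_nonneg: "0 \<le> state_dist s C"
  by (simp add: state_dist_def infdist_nonneg)

text \<open>Embedded indices are integers, so a distance below \<open>1\<close> forces equal
  indices. The infimum need not be attained, which is why the inequalities are strict.\<close>

lemma state_dist_lessE:
  assumes "state_dist s C < \<delta>" "C \<noteq> {}" "\<delta> \<le> 1"
  obtains p where "p \<in> C" "snd p = snd s" "\<bar>fst (fst s) - fst (fst p)\<bar> < \<delta>"
    "\<bar>snd (fst s) - snd (fst p)\<bar> < \<delta>"
proof -
  have "(INF a\<in>embed_state ` C. dist (embed_state s) a) < \<delta>"
    using assms by (simp add: state_dist_def infdist_def)
  from cInf_lessD[OF _ this] assms(2) obtain p where
    p: "p \<in> C" "dist (embed_state s) (embed_state p) < \<delta>" by auto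
  have 1: "dist (fst s) (fst p) < \<delta>" "dist (of_int (snd s) :: real) (of_int (snd p)) < \<delta>"
    using p(2) dist_fst_le[of "embed_state s" "embed_state p"]
      dist_snd_le[of "embed_state s" "embed_state p"] by (auto simp: embed_state_def)
  then have "\<bar>real_of_int (snd s - snd p)\<bar> < 1" using assms(3) by (simp add: dist_real_def)
  then have "snd p = snd s" by linarith
  moreover have "dist (fst (fst s)) (fst (fst p)) < \<delta>" "dist (snd (fst s)) (snd (fst p)) < \<delta>"
    using 1 dist_fst_le[of "fst s" "fst p"] dist_snd_le[of "fst s" "fst p"] by auto
  ultimately show ?thesis using p(1) by (intro that[of p]) (auto simp: dist_real_def)
qed

lemma has_period_mult:
  assumes "has_period z T" "t \<ge> 0"
  shows "z (t + real n * T) = z t"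
proof (induction n)
  case (Suc n)
  have "z (t + real (Suc n) * T) = z ((t + real n * T) + T)" by (simp add: algebra_simps)
  also have "\<dots> = z (t + real n * T)" using assms by (simp add: has_period_def)
  finally show ?case using Suc by simp
qed simp

context hysteresis_cycle
begin

text \<open>The end \<open>s = 2 * xb\<close> is excluded, because the state there already carries
  the other index and begins the other branch. The set is therefore not closed; see
  \<open>closure_cyc\<close>.\<close>

definition cyc :: "state set" where
  "cyc = {pt k (c k) s | k s. k \<in> {-1, 1} \<and> 0 \<le> s \<and> s < 2 * xb}"

text \<open>\<open>1 + M\<close> turns the distance from the cycle into a vertical deviation at the
  same \<open>s\<close>; the exponential carries that deviation along a graph over a length of at
  most \<open>2 * xb\<close>.\<close>

definition "E = exp (2 * (L * xb)) * (1 + M)"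
text \<open>\<open>1 + M\<close> pays for a start beyond the line. In \<open>2 * E\<^sup>2\<close>
  one \<open>E\<close> leads from the initial state to \<open>s = 0\<close>, the other from
  \<open>s = 0\<close> to a later state, and \<open>2\<close> comes from
  \<open>half_map_decay\<close>.\<close>

definition "K = 1 + M + 2 * E\<^sup>2"

lemma E: "exp (2 * (L * xb)) \<le> E" "1 \<le> E"
proof -
  have "1 \<le> exp (2 * (L * xb))" using L_nonneg sm(1) by simp
  moreover have "exp (2 * (L * xb)) * 1 \<le> E"
    unfolding E_def using M_nonneg by (intro mult_left_mono) auto
  ultimately show "exp (2 * (L * xb)) \<le> E" "1 \<le> E" by linarith+
qed

lemma K_pos: "0 < K" using M_nonneg by (simp add: K_def add_pos_nonneg)

lemma cyc_nonempty: "cyc \<noteq> {}"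
proof -
  have "pt 1 (c 1) 0 \<in> cyc" using sm(1) unfolding cyc_def by fastforce
  then show ?thesis by blast
qed

lemma trajectory_determined:
  assumes "trajectory F xb w" "trajectory F xb v" "w 0 = v 0" "t \<ge> 0"
  shows "w t = v t"
  by (rule trajectory_unique[OF assms(1-3) sm(1) loc_lip assms(4)])

lemma graph_gronwall:
  assumes Y: "sol xb k Y" and Z: "sol xb k Z" and s: "\<bar>s - s0\<bar> \<le> 2 * xb"
  shows "\<bar>Y s - Z s\<bar> \<le> exp (2 * (L * xb)) * \<bar>Y s0 - Z s0\<bar>"
proof -
  have "L * \<bar>s - s0\<bar> \<le> L * (2 * xb)" by (rule mult_left_mono[OF s L_nonneg])
  then have "exp (L * \<bar>s - s0\<bar>) * \<bar>Y s0 - Z s0\<bar> \<le> exp (2 * (L * xb)) * \<bar>Y s0 - Z s0\<bar>"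
    by (intro mult_right_mono) auto
  then show ?thesis using sol_gronwall[OF Y Z, of s s0] by linarith
qed

text \<open>The deviation is measured at the state's own \<open>s0\<close> instead of that of the
  nearby point of the cycle; the Lipschitz constant \<open>M\<close> of the graph pays for the
  change. As the state may lie beyond its line, \<open>s0\<close> is bounded below only by
  \<open>- \<delta>\<close>.\<close>

lemma near_cyc:
  assumes v: "valid_state xb s" and d: "state_dist s cyc < \<delta>" "\<delta> \<le> 1"
  obtains s0 where "snd s \<in> {-1, 1}" "- \<delta> < s0" "s0 < 2 * xb"
    "fst (fst s) = of_int (snd s) * (xb - s0)"
    "\<bar>snd (fst s) - graph xb (snd s) (c (snd s)) s0\<bar> \<le> (1 + M) * \<delta>"
proof -
  obtain p where p: "p \<in> cyc" "snd p = snd s" "\<bar>fst (fst s) - fst (fst p)\<bar> < \<delta>"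
    "\<bar>snd (fst s) - snd (fst p)\<bar> < \<delta>"
    using state_dist_lessE[OF d(1) cyc_nonempty d(2)] by blast
  define k where "k = snd s"
  have k: "k \<in> {-1, 1}" and kx: "of_int k * fst (fst s) > - xb"
    using v valid_state_iff[OF sm(1), of "fst s" k] by (auto simp: k_def)
  obtain k' s' where "p = pt k' (c k') s'" "0 \<le> s'" using p(1) by (auto simp: cyc_def)
  then have s': "p = pt k (c k) s'" "0 \<le> s'" using p(2) by (auto simp: pt_def k_def)
  define s0 where "s0 = xb - of_int k * fst (fst s)"
  have ds: "\<bar>s0 - s'\<bar> < \<delta>" using p(3) k by (auto simp: s' pt_def s0_def)
  have "\<bar>graph xb k (c k) s' - graph xb k (c k) s0\<bar> \<le> M * \<delta>"
    using sol_lip[OF graph(1), of xb k "c k" s' s0] mult_left_mono[of "\<bar>s' - s0\<bar>" \<delta> M] ds M_nonneg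
    by (simp add: abs_minus_commute)
  then have "\<bar>snd (fst s) - graph xb k (c k) s0\<bar> \<le> (1 + M) * \<delta>"
    using p(4) by (simp add: s' pt_def algebra_simps)
  moreover have "fst (fst s) = of_int k * (xb - s0)" using k by (auto simp: s0_def)
  moreover have "s0 < 2 * xb" using kx by (simp add: s0_def)
  moreover have "- \<delta> < s0" using ds s'(2) by linarith
  ultimately show ?thesis using that[of s0] k unfolding k_def by blast
qed

text \<open>The only limit states missing from \<open>cyc\<close> have \<open>s = 2 * xb\<close>
  with the index not yet switched, and those are not valid.\<close>

lemma closure_cyc:
  assumes v: "valid_state xb s" and d: "state_dist s cyc = 0"
  shows "s \<in> cyc"
proof -
  define k where "k = snd s"
  define s0 where "s0 = xb - of_int k * fst (fst s)"
  have *: "k \<in> {-1, 1} \<and> - \<delta> < s0 \<and> s0 < 2 * xb \<and> fst (fst s) = of_int k * (xb - s0)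
     \<and> \<bar>snd (fst s) - graph xb k (c k) s0\<bar> \<le> (1 + M) * \<delta>" if "0 < \<delta>" "\<delta> \<le> 1" for \<delta>
  proof -
    have "state_dist s cyc < \<delta>" using d that by simp
    from near_cyc[OF v this that(2)] obtain s1 where s1: "k \<in> {-1, 1}" "- \<delta> < s1" "s1 < 2 * xb"
      "fst (fst s) = of_int k * (xb - s1)"
      "\<bar>snd (fst s) - graph xb k (c k) s1\<bar> \<le> (1 + M) * \<delta>" unfolding k_def by metis
    moreover have "s1 = s0" using s1(1,4) by (auto simp: s0_def)
    ultimately show ?thesis by simp
  qed
  have "0 \<le> s0 + e" if "e > 0" for e using *[of "min e 1"] that by auto
  then have s0: "0 \<le> s0" by (rule field_le_epsilon)
  have "\<bar>snd (fst s) - graph xb k (c k) s0\<bar> \<le> 0 + e" if "e > 0" for e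
  proof -
    have "(1 + M) * min 1 (e / (1 + M)) \<le> (1 + M) * (e / (1 + M))"
      using M_nonneg by (intro mult_left_mono) auto
    then show ?thesis using *[of "min 1 (e / (1 + M))"] that M_nonneg by auto
  qed
  then have "\<bar>snd (fst s) - graph xb k (c k) s0\<bar> \<le> 0" by (rule field_le_epsilon)
  then have "s = pt k (c k) s0"
    using *[of 1] by (simp add: pt_def prod_eq_iff k_def)
  moreover have "k \<in> {-1, 1}" "s0 < 2 * xb" using *[of 1] by simp_all
  ultimately show ?thesis unfolding cyc_def using s0 by blast
qed

text \<open>For \<open>s < 0\<close> the cycle has no state with the same \<open>s\<close>, and
  comparison with its state at \<open>s = 0\<close> costs the term in \<open>\<delta>\<close>. The
  second bound lacks this term and can therefore tend to \<open>0\<close>.\<close>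

lemma state_dist_pt:
  assumes k: "k \<in> {-1, 1}" and s: "- \<delta> \<le> s" "s < 2 * xb" and \<delta>: "0 \<le> \<delta>" "\<delta> \<le> xb"
  shows "state_dist (pt k y s) cyc \<le> (1 + M) * \<delta> + E * \<bar>y - c k\<bar>"
    and "0 \<le> s \<Longrightarrow> state_dist (pt k y s) cyc \<le> E * \<bar>y - c k\<bar>"
proof -
  have "exp (2 * (L * xb)) * \<bar>y - c k\<bar> \<le> E * \<bar>y - c k\<bar>" using E by (intro mult_right_mono) auto
  then have g: "\<bar>graph xb k y s - graph xb k (c k) s\<bar> \<le> E * \<bar>y - c k\<bar>"
    using graph_gronwall[OF graph(1) graph(1), of s 0 k y "c k"] s \<delta> by (simp add: graph(2) abs_le_iff)
  show *: "state_dist (pt k y s) cyc \<le> E * \<bar>y - c k\<bar>" if "0 \<le> s"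
  proof -
    have "pt k (c k) s \<in> cyc" using k s that by (auto simp: cyc_def)
    from state_dist_le[OF this, of "pt k y s"] g show ?thesis by (simp add: pt_def)
  qed
  show "state_dist (pt k y s) cyc \<le> (1 + M) * \<delta> + E * \<bar>y - c k\<bar>"
  proof (cases "0 \<le> s")
    case True
    then show ?thesis using * M_nonneg \<delta> by (simp add: add_increasing)
  next
    case False
    have "pt k (c k) 0 \<in> cyc" using k sm(1) unfolding cyc_def by fastforce
    from state_dist_le[OF this, of "pt k y s"]
    have "state_dist (pt k y s) cyc
        \<le> \<bar>of_int k * (xb - s) - of_int k * xb\<bar> + \<bar>graph xb k y s - graph xb k (c k) 0\<bar>"
      by (simp add: pt_def)
    also have "\<bar>of_int k * (xb - s) - of_int k * xb\<bar> = \<bar>s\<bar>" using k by auto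
    also have "\<bar>graph xb k (c k) s - graph xb k (c k) 0\<bar> \<le> M * \<bar>s\<bar>"
      using sol_lip[OF graph(1), of xb k "c k" s 0] by simp
    then have "\<bar>graph xb k y s - graph xb k (c k) 0\<bar> \<le> M * \<bar>s\<bar> + E * \<bar>y - c k\<bar>"
      using g by linarith
    finally have "state_dist (pt k y s) cyc \<le> (1 + M) * \<bar>s\<bar> + E * \<bar>y - c k\<bar>"
      by (simp add: algebra_simps)
    moreover have "(1 + M) * \<bar>s\<bar> \<le> (1 + M) * \<delta>" using False s M_nonneg by (intro mult_left_mono) auto
    ultimately show ?thesis by linarith
  qed
qed

lemma unrolled_range:
  assumes u: "unrolled v t \<kappa> y \<sigma>" and "t n \<le> u" "u < t (Suc n)"
  shows "\<sigma> n (t n) \<le> \<sigma> n u" "\<sigma> n u < 2 * xb"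
proof -
  have "clock xb (\<kappa> n) (graph xb (\<kappa> n) (y n)) (\<sigma> n)" using u by (simp add: unrolled_def)
  then have "strict_mono (\<sigma> n)" by (rule clock_strict_mono)
  then show "\<sigma> n (t n) \<le> \<sigma> n u" "\<sigma> n u < 2 * xb"
    using assms strict_mono_less_eq[of "\<sigma> n"] strict_monoD[of "\<sigma> n" u "t (Suc n)"]
    by (auto simp: unrolled_def)
qed

text \<open>The trajectory comes from \<open>unroll\<close>; since trajectories are determined by
  their initial states, its bounds hold for every trajectory that starts at
  \<open>s\<close>.\<close>

lemma attraction:
  assumes v: "valid_state xb s" and d: "state_dist s cyc < \<delta>"
    and \<delta>: "\<delta> \<le> 1" "\<delta> \<le> xb" "E * \<delta> \<le> r / 4"
  shows "\<exists>v. trajectory F xb v \<and> v 0 = s \<and> (\<forall>u\<ge>0. state_dist (v u) cyc \<le> K * \<delta>)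
    \<and> ((\<lambda>u. state_dist (v u) cyc) \<longlongrightarrow> 0) at_top"
proof -
  have \<delta>0: "0 < \<delta>" using d state_dist_nonneg[of s cyc] by linarith
  define k where "k = snd s"
  obtain s0 where k: "k \<in> {-1, 1}" and s0: "- \<delta> < s0" "s0 < 2 * xb"
    and x: "fst (fst s) = of_int k * (xb - s0)"
    and y: "\<bar>snd (fst s) - graph xb k (c k) s0\<bar> \<le> (1 + M) * \<delta>"
    using near_cyc[OF v d \<delta>(1)] unfolding k_def by metis
  \<comment> \<open>The graph through the initial state is extended to \<open>s = 0\<close>; its
    value there is the parameter that \<open>unroll\<close> takes.\<close>
  obtain Y where Y: "sol xb k Y" "Y s0 = snd (fst s)" using sol_exists by blast
  define y0 where "y0 = Y 0"
  have Yg: "Y = graph xb k y0" by (rule sol_unique[OF Y(1) graph(1), of 0]) (simp add: graph(2) y0_def)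
  have "\<bar>Y 0 - graph xb k (c k) 0\<bar> \<le> exp (2 * (L * xb)) * \<bar>Y s0 - graph xb k (c k) s0\<bar>"
    by (rule graph_gronwall[OF Y(1) graph(1)]) (use s0 \<delta> in auto)
  also have "\<dots> \<le> exp (2 * (L * xb)) * ((1 + M) * \<delta>)"
    by (rule mult_left_mono) (use y Y(2) in auto)
  finally have y0: "\<bar>y0 - c k\<bar> \<le> E * \<delta>" by (simp add: E_def y0_def graph(2) mult.assoc)
  have "- xb \<le> s0" "\<bar>y0 - c k\<bar> \<le> r / 4" using s0 y0 \<delta> by auto
  from unroll[OF k this(1) s0(2) this(2)] obtain v t \<kappa> yy \<sigma> where
    un: "unrolled v t \<kappa> yy \<sigma>" and 0: "\<kappa> 0 = k" "yy 0 = y0" "\<sigma> 0 0 = s0"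
    and decay: "\<And>n. \<bar>yy n - c (\<kappa> n)\<bar> \<le> 2 * \<rho> ^ n * \<bar>y0 - c k\<bar>" by blast
  have t0: "t 0 = 0" and t_lt: "\<And>n. t n < t (Suc n)" and unb: "\<And>x. \<exists>n. x < t n"
    and \<kappa>: "\<And>n. \<kappa> n \<in> {-1, 1}" and \<sigma>S: "\<And>n. \<sigma> (Suc n) (t (Suc n)) = 0"
    and vpt: "\<And>n u. t n \<le> u \<Longrightarrow> u < t (Suc n) \<Longrightarrow> v u = pt (\<kappa> n) (yy n) (\<sigma> n u)"
    and traj: "trajectory F xb v"
    using un by (auto simp: unrolled_def)
  have v0: "v 0 = s"
    using vpt[of 0 0] t0 t_lt[of 0] 0 x Y(2) Yg by (simp add: pt_def prod_eq_iff k_def)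
  have err: "E * \<bar>yy n - c (\<kappa> n)\<bar> \<le> 2 * E\<^sup>2 * \<delta> * \<rho> ^ n" for n
  proof -
    have "2 * \<rho> ^ n * \<bar>y0 - c k\<bar> \<le> 2 * \<rho> ^ n * (E * \<delta>)"
      using rho y0 by (intro mult_left_mono) auto
    then have "\<bar>yy n - c (\<kappa> n)\<bar> \<le> 2 * \<rho> ^ n * (E * \<delta>)" using decay[of n] by linarith
    then have "E * \<bar>yy n - c (\<kappa> n)\<bar> \<le> E * (2 * \<rho> ^ n * (E * \<delta>))" using E by (intro mult_left_mono) auto
    then show ?thesis by (simp add: power2_eq_square mult_ac)
  qed
  have bound: "state_dist (v u) cyc \<le> K * \<delta>" if "0 \<le> u" for u
  proof -
    obtain n where n: "t n \<le> u" "u < t (Suc n)"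
      using increasing_cover[of t u] unb t0 \<open>0 \<le> u\<close> by auto
    have "- \<delta> \<le> \<sigma> n (t n)" using \<sigma>S 0 s0 t0 \<delta>0 by (cases n) auto
    then have "- \<delta> \<le> \<sigma> n u" "\<sigma> n u < 2 * xb" using unrolled_range[OF un n] by auto
    then have "state_dist (v u) cyc \<le> (1 + M) * \<delta> + E * \<bar>yy n - c (\<kappa> n)\<bar>"
      unfolding vpt[OF n] using \<delta>0 \<delta> by (intro state_dist_pt \<kappa>) auto
    also have "\<dots> \<le> (1 + M) * \<delta> + 2 * E\<^sup>2 * \<delta> * \<rho> ^ n" using err[of n] by simp
    also have "\<dots> \<le> (1 + M) * \<delta> + 2 * E\<^sup>2 * \<delta> * 1"
      using rho \<delta>0 by (intro add_left_mono mult_left_mono power_le_one) auto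
    finally show ?thesis by (simp add: K_def algebra_simps)
  qed
  have "((\<lambda>u. state_dist (v u) cyc) \<longlongrightarrow> 0) at_top"
  proof (rule tendstoI)
    fix e :: real assume e: "e > 0"
    have "(\<lambda>n. 2 * E\<^sup>2 * \<delta> * \<rho> ^ n) \<longlonglongrightarrow> 2 * E\<^sup>2 * \<delta> * 0"
      using rho by (intro tendsto_intros LIMSEQ_realpow_zero) auto
    then have "\<forall>\<^sub>F n in sequentially. 2 * E\<^sup>2 * \<delta> * \<rho> ^ n < e"
      using e by (auto intro: order_tendstoD)
    then obtain N where N: "\<And>n. n \<ge> N \<Longrightarrow> 2 * E\<^sup>2 * \<delta> * \<rho> ^ n < e"
      by (auto simp: eventually_sequentially)
    have smt: "strict_mono t" using t_lt by (simp add: strict_mono_Suc_iff)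
    \<comment> \<open>After the first switch \<open>s\<close> is nonnegative, so the bound of
      \<open>state_dist_pt\<close> without the term in \<open>\<delta>\<close> applies.\<close>
    have "dist (state_dist (v u) cyc) 0 < e" if u: "u \<ge> t (Suc N)" for u
    proof -
      have "t 0 \<le> t (Suc N)" using strict_mono_less_eq[OF smt] by blast
      then obtain n where n: "t n \<le> u" "u < t (Suc n)" using increasing_cover[of t u] unb u by auto
      then have "t (Suc N) < t (Suc n)" using u by linarith
      then have "N < n" using strict_mono_less[OF smt] by simp
      then obtain n' where n': "n = Suc n'" by (cases n) auto
      then have "0 \<le> \<sigma> n u" "\<sigma> n u < 2 * xb" using unrolled_range[OF un n] \<sigma>S[of n'] by auto
      then have "state_dist (v u) cyc \<le> E * \<bar>yy n - c (\<kappa> n)\<bar>"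
        unfolding vpt[OF n] using sm(1) by (intro state_dist_pt(2)[OF \<kappa>, of 0]) auto
      also have "\<dots> \<le> 2 * E\<^sup>2 * \<delta> * \<rho> ^ n" by (rule err)
      also have "\<dots> < e" using N \<open>N < n\<close> by simp
      finally show ?thesis using state_dist_nonneg by simp
    qed
    then show "\<forall>\<^sub>F u in at_top. dist (state_dist (v u) cyc) 0 < e"
      unfolding eventually_at_top_linorder by blast
  qed
  then show ?thesis using traj v0 bound by blast
qed

text \<open>Along the cycle the speed differs from \<open>\<phi> k 0 0\<close> by
  \<open>O(xb)\<close>, and the crossing itself lasts only \<open>O(xb)\<close>; the product is the
  quadratic error. Of \<open>4 * M\<close>, one half stems from the bound on \<open>c k\<close>, the
  other from the drift during the crossing.\<close>

lemma dwell_time: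
  assumes k: "k \<in> {-1, 1}" and cl: "clock xb k (graph xb k (c k)) \<sigma>"
    and ab: "a \<le> b" "\<sigma> a = 0" "\<sigma> b = 2 * xb"
  shows "\<bar>(b - a) - 2 * xb / \<phi> k 0 0\<bar> \<le> 2 * L * (1 + M1 + 4 * M) / m\<^sup>2 * xb\<^sup>2"
proof -
  define B where "B = L * ((1 + M1 + 4 * M) * xb)"
  have B0: "0 \<le> B" using L_nonneg M_nonneg M1_nonneg sm(1) by (simp add: B_def)
  have "\<bar>\<sigma> b - \<sigma> a - \<phi> k 0 0 * (b - a)\<bar> \<le> B * (b - a)"
  proof (rule real_deriv_bound[OF ab(1)])
    fix t assume t: "a \<le> t" "t \<le> b"
    show "(\<sigma> has_real_derivative \<phi> k (of_int k * (xb - \<sigma> t)) (graph xb k (c k) (\<sigma> t))) (at t)"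
      using cl by (simp add: clock_def)
    have "\<sigma> a \<le> \<sigma> t" "\<sigma> t \<le> \<sigma> b"
      using t strict_mono_less_eq[OF clock_strict_mono[OF cl]] by blast+
    then have s: "0 \<le> \<sigma> t" "\<sigma> t \<le> 2 * xb" using ab by auto
    then have 1: "\<bar>of_int k * (xb - \<sigma> t)\<bar> \<le> xb" using k by auto
    have "\<bar>graph xb k (c k) (\<sigma> t)\<bar> \<le> (M1 + 2 * M) * xb + M * (2 * xb)"
      using graph_bound[of xb k "c k" "\<sigma> t"] c_bd[OF k] mult_left_mono[OF s(2) M_nonneg] s(1) by simp
    then have "\<bar>of_int k * (xb - \<sigma> t) - 0\<bar> + \<bar>graph xb k (c k) (\<sigma> t) - 0\<bar> \<le> (1 + M1 + 4 * M) * xb"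
      using 1 by (simp add: algebra_simps)
    then show "\<bar>\<phi> k (of_int k * (xb - \<sigma> t)) (graph xb k (c k) (\<sigma> t)) - \<phi> k 0 0\<bar> \<le> B"
      unfolding B_def using phi_lip mult_left_mono L_nonneg order_trans by meson
  qed
  then have 1: "\<bar>2 * xb - \<phi> k 0 0 * (b - a)\<bar> \<le> B * (b - a)" using ab by simp
  have "m * (b - a) \<le> 2 * xb" using clock_speed(1)[OF cl ab(1)] ab by simp
  then have "b - a \<le> 2 * xb / m" using m_pos by (simp add: field_simps)
  then have "B * (b - a) \<le> B * (2 * xb / m)" by (rule mult_left_mono[OF _ B0])
  with 1 have 2: "\<bar>2 * xb - \<phi> k 0 0 * (b - a)\<bar> \<le> B * (2 * xb / m)" by linarith
  have "(b - a) - 2 * xb / \<phi> k 0 0 = - (2 * xb - \<phi> k 0 0 * (b - a)) / \<phi> k 0 0"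
    using phi_pos[of k 0 0] by (simp add: field_simps)
  then have "\<bar>(b - a) - 2 * xb / \<phi> k 0 0\<bar> = \<bar>2 * xb - \<phi> k 0 0 * (b - a)\<bar> / \<phi> k 0 0"
    using phi_pos[of k 0 0] by (simp add: abs_minus_commute)
  also have "\<dots> \<le> B * (2 * xb / m) / m"
    using 2 phi_lo[of k 0 0] m_pos B0 sm(1) by (intro frac_le) auto
  also have "\<dots> = 2 * L * (1 + M1 + 4 * M) / m\<^sup>2 * xb\<^sup>2" by (simp add: B_def power2_eq_square)
  finally show ?thesis .
qed

lemma cycle_trajectory:
  "\<exists>z T. trajectory F xb z \<and> orbit z = cyc \<and> minimal_period z T
    \<and> \<bar>T - (2 / \<phi> 1 0 0 + 2 / \<phi> (-1) 0 0) * xb\<bar> \<le> 4 * L * (1 + M1 + 4 * M) / m\<^sup>2 * xb\<^sup>2"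
proof -
  obtain z t \<kappa> yy \<sigma> where
    un: "unrolled z t \<kappa> yy \<sigma>" and 0: "\<kappa> 0 = 1" "yy 0 = c 1" "\<sigma> 0 0 = 0"
    and decay: "\<And>n. \<bar>yy n - c (\<kappa> n)\<bar> \<le> 2 * \<rho> ^ n * \<bar>c 1 - c 1\<bar>"
    using unroll[of 1 0 "c 1"] sm(1) r_pos by auto
  have t0: "t 0 = 0" and t_lt: "\<And>n. t n < t (Suc n)" and unb: "\<And>x. \<exists>n. x < t n"
    and \<kappa>: "\<And>n. \<kappa> n \<in> {-1, 1}" and \<kappa>S: "\<And>n. \<kappa> (Suc n) = - \<kappa> n"
    and cl: "\<And>n. clock xb (\<kappa> n) (graph xb (\<kappa> n) (yy n)) (\<sigma> n)"
    and \<sigma>S: "\<And>n. \<sigma> (Suc n) (t (Suc n)) = 0" and \<sigma>r: "\<And>n. \<sigma> n (t (Suc n)) = 2 * xb"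
    and zpt: "\<And>n u. t n \<le> u \<Longrightarrow> u < t (Suc n) \<Longrightarrow> z u = pt (\<kappa> n) (yy n) (\<sigma> n u)"
    and traj: "trajectory F xb z"
    using un by (auto simp: unrolled_def)
  \<comment> \<open>The initial deviation is \<open>0\<close>, so the decay estimate forces all
    later ones to vanish.\<close>
  have yy: "yy n = c (\<kappa> n)" for n using decay[of n] by simp
  have \<sigma>l: "\<sigma> n (t n) = 0" for n using 0 t0 \<sigma>S by (cases n) auto
  define T where "T = t 2"
  have t12: "0 < t 1" "t 1 < T" using t_lt[of 0] t_lt[of 1] t0 by (simp_all add: T_def numeral_2_eq_2)
  have \<kappa>12: "\<kappa> 1 = -1" "\<kappa> 2 = 1" using \<kappa>S[of 0] \<kappa>S[of 1] 0 by (simp_all add: numeral_2_eq_2)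
  have orb: "orbit z = cyc"
  proof (intro equalityI subsetI)
    fix s assume "s \<in> orbit z"
    then obtain u where u: "u \<ge> 0" "s = z u" by (auto simp: orbit_def)
    obtain n where n: "t n \<le> u" "u < t (Suc n)" using increasing_cover[of t u] unb t0 u by auto
    show "s \<in> cyc"
      unfolding cyc_def u(2) zpt[OF n] yy using \<kappa> unrolled_range[OF un n] \<sigma>l by fastforce
  next
    fix p assume "p \<in> cyc"
    then obtain k s where p: "p = pt k (c k) s" "k \<in> {-1, 1}" "0 \<le> s" "s < 2 * xb"
      by (auto simp: cyc_def)
    obtain n where n: "\<kappa> n = k" using p(2) 0 \<kappa>12 by auto
    obtain u where u: "t n \<le> u" "\<sigma> n u = s" using clock_reaches[OF cl[of n], of "t n" s] \<sigma>l p(3) by auto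
    have "u < t (Suc n)"
    proof (rule ccontr)
      assume "\<not> ?thesis"
      then have "\<sigma> n (t (Suc n)) \<le> \<sigma> n u" using strict_mono_less_eq[OF clock_strict_mono[OF cl]] by auto
      then show False using \<sigma>r[of n] u p(4) by simp
    qed
    then have "z u = p" using zpt[OF u(1)] u(2) p(1) n yy by simp
    moreover have "0 \<le> t n" using t0 lift_Suc_mono_le[of t 0 n] t_lt less_imp_le by auto
    ultimately show "p \<in> orbit z" using u(1) unfolding orbit_def by force
  qed
  have z0: "z 0 = pt 1 (c 1) 0" using zpt[of 0 0] t0 t_lt[of 0] 0 by simp
  have zT: "z T = z 0"
    using zpt[of 2 T] t_lt[of 2] \<kappa>12 yy[of 2] \<sigma>l[of 2] z0 by (simp add: T_def)
  have per: "has_period z T"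
    unfolding has_period_def
  proof (intro conjI allI impI)
    show "T > 0" using t12 by simp
    fix u :: real assume "u \<ge> 0"
    then show "z (u + T) = z u"
      using trajectory_determined[OF trajectory_shift[OF traj, of T] traj] zT t12 by simp
  qed
  have "minimal_period z T"
    unfolding minimal_period_def
  proof (intro conjI allI impI per)
    fix S assume S: "has_period z S"
    then have S0: "S > 0" and zS: "z S = pt 1 (c 1) 0"
      using z0 unfolding has_period_def by (auto dest: spec[of _ 0])
    show "T \<le> S"
    proof (rule ccontr)
      assume "\<not> T \<le> S"
      show False
      \<comment> \<open>Before \<open>t 1\<close> the clock has left \<open>0\<close> and cannot
        return; from \<open>t 1\<close> until \<open>T\<close> the index is \<open>-1\<close>. So
        the initial state does not recur before \<open>T\<close>.\<close>
      proof (cases "S < t 1")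
        case True
        then have "z S = pt 1 (c 1) (\<sigma> 0 S)" using zpt[of 0 S] S0 t0 0 by simp
        then have "fst (fst (pt 1 (c 1) (\<sigma> 0 S))) = fst (fst (pt 1 (c 1) 0))" using zS by simp
        then have "\<sigma> 0 S = \<sigma> 0 0" unfolding 0(3) by (simp add: pt_def)
        then show False using strict_monoD[OF clock_strict_mono[OF cl] S0, of 0] by simp
      next
        case False
        then have "z S = pt (-1) (c (-1)) (\<sigma> 1 S)"
          using zpt[of 1 S] \<open>\<not> T \<le> S\<close> \<kappa>12 yy[of 1] by (simp add: T_def numeral_2_eq_2)
        then show False using zS by (simp add: pt_def)
      qed
    qed
  qed
  moreover have "\<bar>T - (2 / \<phi> 1 0 0 + 2 / \<phi> (-1) 0 0) * xb\<bar> \<le> 4 * L * (1 + M1 + 4 * M) / m\<^sup>2 * xb\<^sup>2"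
  proof -
    have "\<bar>(t 1 - 0) - 2 * xb / \<phi> 1 0 0\<bar> \<le> 2 * L * (1 + M1 + 4 * M) / m\<^sup>2 * xb\<^sup>2"
      by (rule dwell_time[of 1 "\<sigma> 0"]) (use cl[of 0] 0 t12 \<sigma>r[of 0] in auto)
    moreover have "\<bar>(T - t 1) - 2 * xb / \<phi> (-1) 0 0\<bar> \<le> 2 * L * (1 + M1 + 4 * M) / m\<^sup>2 * xb\<^sup>2"
      by (rule dwell_time[of "-1" "\<sigma> 1"])
        (use cl[of 1] \<kappa>12 yy[of 1] t12 \<sigma>l[of 1] \<sigma>r[of 1] in \<open>auto simp: T_def numeral_2_eq_2\<close>)
    ultimately have "\<bar>T - (2 * xb / \<phi> 1 0 0 + 2 * xb / \<phi> (-1) 0 0)\<bar>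
        \<le> 2 * L * (1 + M1 + 4 * M) / m\<^sup>2 * xb\<^sup>2 + 2 * L * (1 + M1 + 4 * M) / m\<^sup>2 * xb\<^sup>2" by linarith
    then show ?thesis by (simp add: algebra_simps)
  qed
  ultimately show ?thesis using traj orb by blast
qed

section \<open>Stability, isolation and size of the cycle\<close>

lemma attraction_radius:
  obtains \<delta> where "\<delta> > 0" "\<delta> \<le> 1" "\<delta> \<le> xb" "E * \<delta> \<le> r / 4"
proof (rule that[of "min (min 1 xb) (r / 4 / E)"])
  have "E * min (min 1 xb) (r / 4 / E) \<le> E * (r / 4 / E)" using E by (intro mult_left_mono) auto
  then show "E * min (min 1 xb) (r / 4 / E) \<le> r / 4" using E by auto
qed (use sm(1) r_pos E in auto)

lemma cyc_stable: "orbitally_stable F xb cyc"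
proof -
  obtain \<delta> where \<delta>: "\<delta> > 0" "\<delta> \<le> 1" "\<delta> \<le> xb" "E * \<delta> \<le> r / 4" by (rule attraction_radius)
  have w: "(\<forall>u\<ge>0. state_dist (w u) cyc \<le> K * d) \<and> ((\<lambda>u. state_dist (w u) cyc) \<longlongrightarrow> 0) at_top"
    if w: "trajectory F xb w" "state_dist (w 0) cyc < d" and d: "d \<le> \<delta>" for w d
  proof -
    have "E * d \<le> E * \<delta>" using d E by (intro mult_left_mono) auto
    then obtain v where v: "trajectory F xb v" "v 0 = w 0" "\<And>u. u\<ge>0 \<Longrightarrow> state_dist (v u) cyc \<le> K * d"
      "((\<lambda>u. state_dist (v u) cyc) \<longlongrightarrow> 0) at_top"
      using attraction[OF trajectoryD(2)[OF w(1)] w(2)] d \<delta> by force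
    have eq: "v u = w u" if "u \<ge> 0" for u using trajectory_determined[OF v(1) w(1) v(2) that] .
    have "\<forall>\<^sub>F u in at_top. state_dist (v u) cyc = state_dist (w u) cyc"
      using eventually_ge_at_top[of "0 :: real"] by eventually_elim (simp add: eq)
    from Lim_transform_eventually[OF v(4) this] v(3) eq show ?thesis by auto
  qed
  show ?thesis
    unfolding orbitally_stable_def
  proof (intro conjI)
    show "\<exists>\<delta>>0. \<forall>s. valid_state xb s \<and> state_dist s cyc < \<delta> \<longrightarrow> (\<exists>w. trajectory F xb w \<and> w 0 = s)"
      using attraction[OF _ _ \<delta>(2-4)] \<delta>(1) by blast
    show "\<forall>\<epsilon>>0. \<exists>\<delta>>0. \<forall>w. trajectory F xb w \<and> state_dist (w 0) cyc < \<delta> \<longrightarrow>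
        (\<forall>t\<ge>0. state_dist (w t) cyc < \<epsilon>)"
    proof (intro allI impI)
      fix \<epsilon> :: real assume \<epsilon>: "\<epsilon> > 0"
      define d where "d = min \<delta> (\<epsilon> / (2 * K))"
      have d: "d > 0" "d \<le> \<delta>" using \<delta> \<epsilon> K_pos by (auto simp: d_def)
      have "K * d \<le> K * (\<epsilon> / (2 * K))" using K_pos by (intro mult_left_mono) (auto simp: d_def)
      also have "\<dots> < \<epsilon>" using K_pos \<epsilon> by simp
      finally have "K * d < \<epsilon>" .
      then show "\<exists>\<delta>>0. \<forall>w. trajectory F xb w \<and> state_dist (w 0) cyc < \<delta> \<longrightarrow>
          (\<forall>t\<ge>0. state_dist (w t) cyc < \<epsilon>)"
        using d w by (intro exI[of _ d]) fastforce
    qed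
    show "\<exists>\<delta>>0. \<forall>w. trajectory F xb w \<and> state_dist (w 0) cyc < \<delta> \<longrightarrow>
        ((\<lambda>t. state_dist (w t) cyc) \<longlongrightarrow> 0) at_top"
      using \<delta>(1) w by blast
  qed
qed

text \<open>A periodic trajectory attracted by the cycle has distance \<open>0\<close> from it, and the cycle is
  closed in the set of valid states.\<close>

lemma cyc_isolated:
  assumes z: "trajectory F xb z" "orbit z = cyc" "has_period z T"
    and w: "trajectory F xb w" "has_period w S" "s \<in> orbit w"
    and d: "\<And>v. trajectory F xb v \<Longrightarrow> state_dist (v 0) cyc < \<delta> \<Longrightarrow>
      ((\<lambda>t. state_dist (v t) cyc) \<longlongrightarrow> 0) at_top"
    and s: "state_dist s cyc < \<delta>"
  shows "orbit w = cyc"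
proof -
  obtain a where a: "a \<ge> 0" "s = w a" using w(3) by (auto simp: orbit_def)
  have S: "S > 0" and T: "T > 0" using w(2) z(3) by (auto simp: has_period_def)
  have lim: "((\<lambda>t. state_dist (w (t + a)) cyc) \<longlongrightarrow> 0) at_top"
    using d[OF trajectory_shift[OF w(1) a(1)]] s a by simp
  have mem: "w t \<in> cyc" if t: "t \<ge> 0" for t
  proof -
    have "filterlim (\<lambda>n. (t - a) + real n * S) at_top sequentially"
      using S by (intro filterlim_tendsto_add_at_top[OF tendsto_const]
        filterlim_at_top_mult_tendsto_pos[OF tendsto_const _ filterlim_real_sequentially])
    from filterlim_compose[OF lim this]
    have "(\<lambda>n. state_dist (w (t + real n * S)) cyc) \<longlonglongrightarrow> 0" by (simp add: algebra_simps)
    then have "(\<lambda>n :: nat. state_dist (w t) cyc) \<longlonglongrightarrow> 0" by (simp add: has_period_mult[OF w(2) t])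
    then have "state_dist (w t) cyc = 0" by (simp add: LIMSEQ_const_iff)
    then show ?thesis using closure_cyc trajectoryD(2)[OF w(1) t] by blast
  qed
  have "w 0 \<in> orbit z" using mem z(2) by simp
  then obtain b where b: "b \<ge> 0" "w 0 = z b" by (auto simp: orbit_def)
  have wz: "w u = z (u + b)" if "u \<ge> 0" for u
    using trajectory_determined[OF w(1) trajectory_shift[OF z(1) b(1)] _ that] b by simp
  show ?thesis
  proof (intro equalityI subsetI)
    show "s \<in> cyc" if "s \<in> orbit w" for s using that mem by (auto simp: orbit_def)
    fix s assume "s \<in> cyc"
    then obtain u where u: "u \<ge> 0" "s = z u" using z(2) by (auto simp: orbit_def)
    \<comment> \<open>\<open>w\<close> follows \<open>z\<close> from time \<open>b\<close> on;
      \<open>n\<close> further periods move the given time past \<open>b\<close>.\<close>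
    obtain n where "b < real n * T" using reals_Archimedean3[OF T] by blast
    then have n: "u + real n * T - b \<ge> 0" using u by simp
    have "s = w (u + real n * T - b)"
      using wz[OF n] has_period_mult[OF z(3) u(1), of n] u(2) by simp
    then show "s \<in> orbit w" using n by (auto simp: orbit_def)
  qed
qed

theorem limit_cycle_exists:
  "\<exists>z T. limit_cycle F xb z \<and> orbitally_stable F xb (orbit z) \<and> minimal_period z T
    \<and> \<bar>T - (2 / \<phi> 1 0 0 + 2 / \<phi> (-1) 0 0) * xb\<bar> \<le> 4 * L * (1 + M1 + 4 * M) / m\<^sup>2 * xb\<^sup>2
    \<and> 0 \<le> max_dist_origin z \<and> max_dist_origin z \<le> (1 + M1 + 4 * M) * xb"
proof -
  obtain z T where z: "trajectory F xb z" "orbit z = cyc" "minimal_period z T"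
    and T: "\<bar>T - (2 / \<phi> 1 0 0 + 2 / \<phi> (-1) 0 0) * xb\<bar> \<le> 4 * L * (1 + M1 + 4 * M) / m\<^sup>2 * xb\<^sup>2"
    using cycle_trajectory by blast
  have per: "has_period z T" using z(3) by (simp add: minimal_period_def)
  have idx: "\<exists>s\<in>cyc. snd s = k" if "k \<in> {-1, 1}" for k
    using that sm(1) by (intro bexI[of _ "pt k (c k) 0"]) (auto simp: cyc_def pt_def)
  have "limit_cycle F xb z"
    unfolding limit_cycle_def z(2)
  proof (intro conjI z(1))
    show "\<exists>T. has_period z T" using per by blast
    show "\<not> (\<forall>t\<ge>0. z t = z 0)"
    proof
      assume "\<forall>t\<ge>0. z t = z 0"
      then have "cyc \<subseteq> {z 0}" unfolding z(2)[symmetric] orbit_def by blast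
      moreover have "\<exists>s\<in>cyc. snd s = 1" "\<exists>s\<in>cyc. snd s = -1" by (rule idx, simp)+
      then obtain s1 s2 where "s1 \<in> cyc" "snd s1 = 1" "s2 \<in> cyc" "snd s2 = -1" by metis
      ultimately have "s1 = z 0" "s2 = z 0" by blast+
      with \<open>snd s1 = 1\<close> \<open>snd s2 = -1\<close> show False by simp
    qed
    obtain \<delta> where "\<delta> > 0" "\<And>v. trajectory F xb v \<Longrightarrow> state_dist (v 0) cyc < \<delta> \<Longrightarrow>
      ((\<lambda>t. state_dist (v t) cyc) \<longlongrightarrow> 0) at_top"
      using cyc_stable unfolding orbitally_stable_def by blast
    then show "\<exists>\<epsilon>>0. \<forall>w. trajectory F xb w \<and> (\<exists>T. has_period w T) \<and>
        (\<exists>s\<in>orbit w. state_dist s cyc < \<epsilon>) \<longrightarrow> orbit w = cyc"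
      using cyc_isolated[OF z(1,2) per] by blast
  qed
  moreover have bd: "norm (fst s) \<le> (1 + M1 + 4 * M) * xb" if "s \<in> cyc" for s
  proof -
    obtain k u where s: "s = pt k (c k) u" and k: "k \<in> {-1, 1}" and u: "0 \<le> u" "u < 2 * xb"
      using \<open>s \<in> cyc\<close> by (auto simp: cyc_def)
    have "norm (fst s) \<le> \<bar>of_int k * (xb - u)\<bar> + \<bar>graph xb k (c k) u\<bar>"
      unfolding s pt_def by (simp add: norm_Pair sqrt_sum_squares_le_sum_abs)
    also have "\<bar>of_int k * (xb - u)\<bar> \<le> xb" using k u by auto
    also have "\<bar>graph xb k (c k) u\<bar> \<le> (M1 + 2 * M) * xb + M * (2 * xb)"
      using graph_bound[of xb k "c k" u] c_bd[OF k] mult_left_mono[OF less_imp_le[OF u(2)] M_nonneg] u(1)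
      by simp
    finally show ?thesis by (simp add: algebra_simps)
  qed
  moreover obtain s where s: "s \<in> cyc" using cyc_nonempty by blast
  have "0 \<le> max_dist_origin z"
    unfolding max_dist_origin_def z(2)
    by (rule cSUP_upper2[OF _ s]) (use bd in \<open>auto intro!: bdd_aboveI2\<close>)
  moreover have "max_dist_origin z \<le> (1 + M1 + 4 * M) * xb"
    unfolding max_dist_origin_def z(2) by (rule cSUP_least[OF cyc_nonempty bd])
  ultimately show ?thesis using cyc_stable z(2,3) T by (intro exI[of _ z] exI[of _ T]) simp
qed

end

context hysteresis
begin

text \<open>The constants of \<open>limit_cycle_exists\<close> depend on the fields and the box but
  not on \<open>xb\<close>, so a single \<open>C\<close> serves all small \<open>xb\<close>.\<close>

theorem small_cycles:
  "\<exists>x0>0. \<exists>C. \<forall>xb\<in>{0<..<x0}. \<exists>z T.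
    limit_cycle F xb z \<and> orbitally_stable F xb (orbit z) \<and> minimal_period z T
    \<and> \<bar>T - (2 / \<phi> 1 0 0 + 2 / \<phi> (-1) 0 0) * xb\<bar> \<le> C * xb\<^sup>2
    \<and> 0 \<le> max_dist_origin z \<and> max_dist_origin z \<le> C * xb"
proof -
  define C1 where "C1 = 4 * L * (1 + M1 + 4 * M) / m\<^sup>2"
  define C2 where "C2 = 1 + M1 + 4 * M"
  \<comment> \<open>The two bounds are the two smallness conditions in \<open>small\<close>, solved
    for \<open>xb\<close>.\<close>
  define x0 where "x0 = min (r / (8 * (1 + M + M1))) (1 / (2 * (A + 1)))"
  have pos: "0 < 1 + M + M1" "0 < A + 1" using M_nonneg M1_nonneg by (auto simp: A_def)
  have x0: "x0 > 0" using pos r_pos by (simp add: x0_def)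
  have "\<exists>z T. limit_cycle F xb z \<and> orbitally_stable F xb (orbit z) \<and> minimal_period z T
    \<and> \<bar>T - (2 / \<phi> 1 0 0 + 2 / \<phi> (-1) 0 0) * xb\<bar> \<le> max C1 C2 * xb\<^sup>2
    \<and> 0 \<le> max_dist_origin z \<and> max_dist_origin z \<le> max C1 C2 * xb"
    if xb: "xb \<in> {0<..<x0}" for xb
  proof -
    have "xb < r / (8 * (1 + M + M1))" "xb < 1 / (2 * (A + 1))" using xb by (auto simp: x0_def)
    then have "xb * (8 * (1 + M + M1)) < r" "xb * (2 * (A + 1)) < 1"
      using pos by (simp_all add: pos_less_divide_eq)
    then have sm: "small xb" using xb by (simp add: small_def algebra_simps)
    obtain y where y: "\<bar>y\<bar> \<le> M1 * xb" "half_map xb (-1) (half_map xb 1 y) = y"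
      using cycle_exists[OF sm] by blast
    define c where "c k = (if k = 1 then y else half_map xb 1 y)" for k :: int
    have "\<bar>half_map xb 1 y\<bar> \<le> M1 * xb + 2 * (M * xb)"
      using graph_bound[of xb 1 y "2 * xb"] y(1) xb by (simp add: half_map_def)
    then interpret hysteresis_cycle F h \<phi> \<alpha> r L M m m' xb c
      using sm y smallD[OF sm] by unfold_locales (auto simp: c_def algebra_simps)
    obtain z T where "limit_cycle F xb z" "orbitally_stable F xb (orbit z)" "minimal_period z T"
      "\<bar>T - (2 / \<phi> 1 0 0 + 2 / \<phi> (-1) 0 0) * xb\<bar> \<le> C1 * xb\<^sup>2"
      "0 \<le> max_dist_origin z" "max_dist_origin z \<le> C2 * xb"
      using limit_cycle_exists unfolding C1_def C2_def by blast
    moreover have "C1 * xb\<^sup>2 \<le> max C1 C2 * xb\<^sup>2" "C2 * xb \<le> max C1 C2 * xb"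
      using xb by (auto intro!: mult_right_mono)
    ultimately show ?thesis by (meson order_trans)
  qed
  then show ?thesis using x0 by blast
qed

end

section \<open>Vector fields of class \<open>C\<^sup>1\<close>\<close>

definition C1_partials where
  "C1_partials f f1 f2 \<longleftrightarrow>
    (\<forall>p. (f has_derivative (\<lambda>h. f1 p * fst h + f2 p * snd h)) (at p))
    \<and> continuous_on UNIV f1 \<and> continuous_on UNIV (f2 :: real \<times> real \<Rightarrow> real)"

lemma class_C_continuous: "class_C n f \<Longrightarrow> continuous_on UNIV f"
proof (cases n)
  case (Suc m)
  moreover assume "class_C n f"
  ultimately obtain f1 f2 where "\<And>p. (f has_derivative (\<lambda>h. f1 p * fst h + f2 p * snd h)) (at p)"
    by auto
  then show ?thesis by (meson has_derivative_continuous continuous_at_imp_continuous_on)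
qed simp

lemma class_C_partials:
  assumes "class_C 4 f"
  obtains f1 f2 where "C1_partials f f1 f2"
proof -
  have "class_C (Suc 3) f" using assms by simp
  then obtain f1 f2 where "\<forall>p. (f has_derivative (\<lambda>h. f1 p * fst h + f2 p * snd h)) (at p)"
    "class_C 3 f1" "class_C 3 f2" unfolding class_C.simps by blast
  then show ?thesis using that[of f1 f2] class_C_continuous unfolding C1_partials_def by blast
qed

lemma C1_partials_continuous: "C1_partials f f1 f2 \<Longrightarrow> continuous_on UNIV f"
  unfolding C1_partials_def by (meson has_derivative_continuous continuous_at_imp_continuous_on)

lemma C1_partials_minus: "C1_partials f f1 f2 \<Longrightarrow> C1_partials (\<lambda>p. - f p) (\<lambda>p. - f1 p) (\<lambda>p. - f2 p)"
  unfolding C1_partials_def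
  by (auto intro!: continuous_intros derivative_eq_intros simp: algebra_simps)

lemma C1_partials_y:
  assumes "C1_partials f f1 f2"
  shows "((\<lambda>y. f (x, y)) has_real_derivative f2 (x, y)) (at y)"
proof -
  have "((\<lambda>y. (x, y)) has_derivative (\<lambda>h. (0, h))) (at y)"
    by (auto intro!: derivative_eq_intros)
  moreover have "(f has_derivative (\<lambda>h. f1 (x, y) * fst h + f2 (x, y) * snd h)) (at (x, y))"
    using assms by (simp add: C1_partials_def)
  ultimately have "((\<lambda>y. f (x, y)) has_derivative
      (\<lambda>h. f1 (x, y) * fst (0 :: real, h) + f2 (x, y) * snd (0 :: real, h))) (at y)"
    by (rule has_derivative_compose)
  then show ?thesis by (simp add: has_field_derivative_def mult.commute[of _ "f2 (x, y)"])
qed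

lemma partial_y_eq: "C1_partials f f1 f2 \<Longrightarrow> partial_y f (x, y) = f2 (x, y)"
  unfolding partial_y_def using C1_partials_y by (simp add: DERIV_imp_deriv)

lemma continuous_bounded_cball:
  fixes g :: "'a :: heine_borel \<Rightarrow> real"
  assumes "continuous_on UNIV g"
  shows "\<exists>b. \<forall>q\<in>cball p r. \<bar>g q\<bar> \<le> b"
proof -
  have "compact (g ` cball p r)"
    using assms by (intro compact_continuous_image) (auto intro: continuous_on_subset)
  from compact_imp_bounded[OF this] show ?thesis by (auto simp: bounded_iff)
qed

lemma C1_partials_lipschitz:
  assumes f: "C1_partials f f1 f2"
  obtains B where "B \<ge> 0"
    "\<And>q q'. q \<in> cball p r \<Longrightarrow> q' \<in> cball p r \<Longrightarrow> \<bar>f q - f q'\<bar> \<le> B * norm (q - q')"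
proof -
  obtain b1 b2 where b: "\<And>q. q \<in> cball p r \<Longrightarrow> \<bar>f1 q\<bar> \<le> b1" "\<And>q. q \<in> cball p r \<Longrightarrow> \<bar>f2 q\<bar> \<le> b2"
    using f continuous_bounded_cball[of f1 p r] continuous_bounded_cball[of f2 p r]
    unfolding C1_partials_def by meson
  define B where "B = \<bar>b1\<bar> + \<bar>b2\<bar>"
  have "norm (f q - f q') \<le> B * norm (q - q')" if "q \<in> cball p r" "q' \<in> cball p r" for q q'
  proof (rule differentiable_bound[OF convex_cball])
    fix x assume x: "x \<in> cball p r"
    show "(f has_derivative (\<lambda>h. f1 x * fst h + f2 x * snd h)) (at x within cball p r)"
      using f unfolding C1_partials_def by (blast intro: has_derivative_at_withinI)
    show "onorm (\<lambda>h. f1 x * fst h + f2 x * snd h) \<le> B"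
    proof (rule onorm_le)
      fix h :: "real \<times> real"
      have 1: "\<bar>fst h\<bar> \<le> norm h" "\<bar>snd h\<bar> \<le> norm h" by (metis real_norm_def norm_fst_le norm_snd_le prod.collapse)+
      have "norm (f1 x * fst h + f2 x * snd h) \<le> \<bar>f1 x\<bar> * \<bar>fst h\<bar> + \<bar>f2 x\<bar> * \<bar>snd h\<bar>"
        by (metis abs_mult abs_triangle_ineq real_norm_def)
      also have "\<dots> \<le> \<bar>b1\<bar> * norm h + \<bar>b2\<bar> * norm h"
        using b[OF x] 1 by (intro add_mono mult_mono) auto
      finally show "norm (f1 x * fst h + f2 x * snd h) \<le> B * norm h"
        by (simp add: B_def algebra_simps)
    qed
  qed (use that in auto)
  then show ?thesis by (intro that[of B]) (auto simp: B_def)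
qed

text \<open>What the locale \<open>hysteresis\<close> needs from one index, on a box of radius
  \<open>R\<close>: \<open>f\<close> is the speed, \<open>g / f\<close> the slope
  \<open>dy/ds\<close> and \<open>a\<close> the one-sided constant.\<close>

definition slope_bounded where
  "slope_bounded f g a R L M m m' \<longleftrightarrow>
    (\<forall>x y x' y'. \<bar>x\<bar> \<le> R \<longrightarrow> \<bar>y\<bar> \<le> R \<longrightarrow> \<bar>x'\<bar> \<le> R \<longrightarrow> \<bar>y'\<bar> \<le> R \<longrightarrow>
     m \<le> f (x, y) \<and> f (x, y) \<le> m' \<and> \<bar>g (x, y) / f (x, y)\<bar> \<le> M
     \<and> \<bar>f (x, y) - f (x', y')\<bar> \<le> L * (\<bar>x - x'\<bar> + \<bar>y - y'\<bar>)
     \<and> \<bar>g (x, y) / f (x, y) - g (x', y') / f (x', y')\<bar> \<le> L * (\<bar>x - x'\<bar> + \<bar>y - y'\<bar>)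
     \<and> (y - y') * (g (x, y) / f (x, y) - g (x, y') / f (x, y')) \<le> a * (y - y')\<^sup>2)"
  for f g :: "real \<times> real \<Rightarrow> real" and a R L M m m' :: real

lemma slope_boundedD:
  assumes "slope_bounded f g a R L M m m'" "\<bar>x\<bar> \<le> R" "\<bar>y\<bar> \<le> R" "\<bar>x'\<bar> \<le> R" "\<bar>y'\<bar> \<le> R"
  shows "m \<le> f (x, y)" "f (x, y) \<le> m'" "\<bar>g (x, y) / f (x, y)\<bar> \<le> M"
    "\<bar>f (x, y) - f (x', y')\<bar> \<le> L * (\<bar>x - x'\<bar> + \<bar>y - y'\<bar>)"
    "\<bar>g (x, y) / f (x, y) - g (x', y') / f (x', y')\<bar> \<le> L * (\<bar>x - x'\<bar> + \<bar>y - y'\<bar>)"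
    "(y - y') * (g (x, y) / f (x, y) - g (x, y') / f (x, y')) \<le> a * (y - y')\<^sup>2"
  using assms(1)[unfolded slope_bounded_def, rule_format, OF assms(2-5)] by auto

text \<open>\<open>(g2 f - g f2) / f\<^sup>2\<close> is the \<open>y\<close>-derivative of the slope \<open>g / f\<close>.\<close>

lemma slope_bounds:
  assumes f: "C1_partials f f1 f2" and g: "C1_partials g g1 g2" and pos: "f (0, 0) > 0" and e: "\<epsilon> > 0"
  shows "\<exists>R L M m m'. 0 < R \<and> 0 < m \<and> 0 \<le> L \<and> slope_bounded f g
    ((g2 (0, 0) * f (0, 0) - g (0, 0) * f2 (0, 0)) / (f (0, 0))\<^sup>2 + \<epsilon>) R L M m m'"
proof -
  define D where "D p = (g2 p * f p - g p * f2 p) / (f p)\<^sup>2" for p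
  note cont = C1_partials_continuous[OF f] C1_partials_continuous[OF g]
  have cont2: "continuous_on UNIV f2" "continuous_on UNIV g2" using f g by (auto simp: C1_partials_def)
  have at0: "isCont f (0, 0)" "isCont g (0, 0)" "isCont f2 (0, 0)" "isCont g2 (0, 0)"
    using cont cont2 by (auto simp: continuous_on_eq_continuous_at)
  have "isCont D (0, 0)"
    unfolding D_def using pos by (intro continuous_intros at0) auto
  then have "\<forall>\<^sub>F p in nhds (0, 0). D p < D (0, 0) + \<epsilon>"
    using e by (intro order_tendstoD) (auto simp: isCont_def tendsto_at_iff_tendsto_nhds)
  moreover have "\<forall>\<^sub>F p in nhds (0, 0). f (0, 0) / 2 < f p"
    using at0(1) pos by (intro order_tendstoD) (auto simp: isCont_def tendsto_at_iff_tendsto_nhds)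
  ultimately have "\<forall>\<^sub>F p in nhds (0, 0). D p < D (0, 0) + \<epsilon> \<and> f (0, 0) / 2 < f p"
    by (rule eventually_conj)
  then obtain d where d: "d > 0" "\<And>p. dist p (0, 0) < d \<Longrightarrow> D p < D (0, 0) + \<epsilon> \<and> f (0, 0) / 2 < f p"
    by (auto simp: eventually_nhds_metric)
  \<comment> \<open>Points of the box have norm at most \<open>2 * R\<close>, which is less than
    \<open>d\<close> and at most \<open>2\<close>; this fits the continuity estimates and the ball
    of the Lipschitz bounds.\<close>
  define R where "R = min 1 (d / 3)"
  have R: "R > 0" using d by (simp add: R_def)
  have nrm: "norm ((x, y) :: real \<times> real) \<le> \<bar>x\<bar> + \<bar>y\<bar>" for x y
    by (simp add: norm_Pair sqrt_sum_squares_le_sum_abs)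
  have box: "D (x, y) < D (0, 0) + \<epsilon>" "f (0, 0) / 2 < f (x, y)" "(x, y) \<in> cball (0, 0) 2"
    if "\<bar>x\<bar> \<le> R" "\<bar>y\<bar> \<le> R" for x y
  proof -
    have "norm (x, y) \<le> 2 * R" using nrm[of x y] that by simp
    then have "norm (x, y) < d" "norm (x, y) \<le> 2" using d(1) by (auto simp: R_def)
    moreover have "(0, 0) = (0 :: real \<times> real)" by (simp add: zero_prod_def)
    ultimately show "D (x, y) < D (0, 0) + \<epsilon>" "f (0, 0) / 2 < f (x, y)" "(x, y) \<in> cball (0, 0) 2"
      using d(2)[of "(x, y)"] by simp_all
  qed
  define m where "m = f (0, 0) / 2"
  have m: "m > 0" using pos by (simp add: m_def)
  obtain Bf where Bf: "Bf \<ge> 0"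
    "\<And>q q'. q \<in> cball (0, 0) 2 \<Longrightarrow> q' \<in> cball (0, 0) 2 \<Longrightarrow> \<bar>f q - f q'\<bar> \<le> Bf * norm (q - q')"
    using C1_partials_lipschitz[OF f] by blast
  obtain Bg where Bg: "Bg \<ge> 0"
    "\<And>q q'. q \<in> cball (0, 0) 2 \<Longrightarrow> q' \<in> cball (0, 0) 2 \<Longrightarrow> \<bar>g q - g q'\<bar> \<le> Bg * norm (q - q')"
    using C1_partials_lipschitz[OF g] by blast
  obtain m' G where m': "\<And>q. q \<in> cball (0, 0) 2 \<Longrightarrow> \<bar>f q\<bar> \<le> m'"
    and G: "\<And>q. q \<in> cball (0, 0) 2 \<Longrightarrow> \<bar>g q\<bar> \<le> G"
    using continuous_bounded_cball[OF cont(1)] continuous_bounded_cball[OF cont(2)] by meson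
  have z: "(0, 0) \<in> cball (0 :: real, 0 :: real) 2" by simp
  have m'0: "0 \<le> m'" and G0: "0 \<le> G" using m'[OF z] G[OF z] by linarith+
  \<comment> \<open>\<open>Bf\<close> serves \<open>f\<close>. The rest serves the quotient, whose
    differences have a numerator of at most \<open>Bg * m' + G * Bf\<close> times the distance and a
    denominator of at least \<open>m\<^sup>2\<close>.\<close>
  define L where "L = Bf + (Bg * m' + G * Bf) / m\<^sup>2"
  have L0: "0 \<le> (Bg * m' + G * Bf) / m\<^sup>2" using Bf Bg m'0 G0 by simp
  show ?thesis
    unfolding slope_bounded_def
  proof (intro exI conjI allI impI)
    show "0 < R" "0 < m" by fact+
    show "0 \<le> L" using L0 Bf by (simp add: L_def)
    fix x y x' y' assume b: "\<bar>x\<bar> \<le> R" "\<bar>y\<bar> \<le> R" "\<bar>x'\<bar> \<le> R" "\<bar>y'\<bar> \<le> R"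
    let ?p = "(x, y)" and ?q = "(x', y')" and ?d = "\<bar>x - x'\<bar> + \<bar>y - y'\<bar>"
    note p = box[OF b(1,2)] and q = box[OF b(3,4)]
    have fp: "m \<le> f ?p" and fq: "m \<le> f ?q" using p(2) q(2) by (simp_all add: m_def)
    show "m \<le> f ?p" by fact
    show "f ?p \<le> m'" using m'[OF p(3)] by simp
    have "\<bar>g ?p / f ?p\<bar> = \<bar>g ?p\<bar> / f ?p" using fp m by simp
    also have "\<dots> \<le> G / m" using G[OF p(3)] fp m by (intro frac_le) auto
    finally show "\<bar>g ?p / f ?p\<bar> \<le> G / m" .
    have dist: "norm (?p - ?q) \<le> ?d" using nrm[of "x - x'" "y - y'"] by simp
    have lf: "\<bar>f ?p - f ?q\<bar> \<le> Bf * ?d"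
      using Bf(2)[OF p(3) q(3)] mult_left_mono[OF dist Bf(1)] by linarith
    have lg: "\<bar>g ?p - g ?q\<bar> \<le> Bg * ?d"
      using Bg(2)[OF p(3) q(3)] mult_left_mono[OF dist Bg(1)] by linarith
    have "Bf * ?d \<le> L * ?d" by (rule mult_right_mono) (use L0 in \<open>auto simp: L_def\<close>)
    then show "\<bar>f ?p - f ?q\<bar> \<le> L * ?d" using lf by linarith
    have "g ?p / f ?p - g ?q / f ?q = ((g ?p - g ?q) * f ?q - g ?q * (f ?p - f ?q)) / (f ?p * f ?q)"
      using fp fq m by (simp add: field_simps)
    then have "\<bar>g ?p / f ?p - g ?q / f ?q\<bar>
        = \<bar>(g ?p - g ?q) * f ?q - g ?q * (f ?p - f ?q)\<bar> / (f ?p * f ?q)"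
      using fp fq m by (simp add: abs_mult)
    also have "\<dots> \<le> (Bg * m' + G * Bf) * ?d / (m * m)"
    proof (rule frac_le)
      have "\<bar>(g ?p - g ?q) * f ?q\<bar> \<le> Bg * ?d * m'"
        unfolding abs_mult using m'[OF q(3)] Bg(1) by (intro mult_mono lg) auto
      moreover have "\<bar>g ?q * (f ?p - f ?q)\<bar> \<le> G * (Bf * ?d)"
        unfolding abs_mult using G[OF q(3)] G0 by (intro mult_mono lf) auto
      ultimately have "\<bar>(g ?p - g ?q) * f ?q - g ?q * (f ?p - f ?q)\<bar> \<le> Bg * ?d * m' + G * (Bf * ?d)"
        by linarith
      then show "\<bar>(g ?p - g ?q) * f ?q - g ?q * (f ?p - f ?q)\<bar> \<le> (Bg * m' + G * Bf) * ?d"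
        by (simp add: algebra_simps)
      show "m * m \<le> f ?p * f ?q" using fp fq m by (intro mult_mono) auto
    qed (use m Bf Bg m'0 G0 in auto)
    also have "\<dots> \<le> L * ?d"
    proof -
      have "(Bg * m' + G * Bf) / m\<^sup>2 * ?d \<le> L * ?d"
        by (rule mult_right_mono) (use Bf in \<open>auto simp: L_def\<close>)
      then show ?thesis by (simp add: power2_eq_square)
    qed
    finally show "\<bar>g ?p / f ?p - g ?q / f ?q\<bar> \<le> L * ?d" .
    have der: "((\<lambda>y. g (x, y) / f (x, y)) has_real_derivative D (x, u)) (at u)" if "\<bar>u\<bar> \<le> R" for u
    proof -
      have "f (x, u) \<noteq> 0" using box(2)[OF b(1) that] pos by simp
      from DERIV_divide[OF C1_partials_y[OF g] C1_partials_y[OF f] this]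
      show ?thesis by (simp add: D_def power2_eq_square)
    qed
    \<comment> \<open>Only the upper bound on \<open>D\<close> is used, so the constant keeps its
      sign.\<close>
    have mvt: "(v - u) * (g (x, v) / f (x, v) - g (x, u) / f (x, u)) \<le> (D (0, 0) + \<epsilon>) * (v - u)\<^sup>2"
      if uv: "u < v" "\<bar>u\<bar> \<le> R" "\<bar>v\<bar> \<le> R" for u v
    proof -
      obtain \<xi> where \<xi>: "u < \<xi>" "\<xi> < v"
        "g (x, v) / f (x, v) - g (x, u) / f (x, u) = (v - u) * D (x, \<xi>)"
        using MVT2[of u v "\<lambda>y. g (x, y) / f (x, y)" "\<lambda>y. D (x, y)"] der uv by auto
      have "D (x, \<xi>) \<le> D (0, 0) + \<epsilon>" using box(1)[OF b(1), of \<xi>] \<xi> uv by (simp add: abs_le_iff)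
      then have "D (x, \<xi>) * (v - u)\<^sup>2 \<le> (D (0, 0) + \<epsilon>) * (v - u)\<^sup>2" by (rule mult_right_mono) simp
      then show ?thesis unfolding \<xi>(3) by (simp add: power2_eq_square mult_ac)
    qed
    have "(y - y') * (g (x, y) / f (x, y) - g (x, y') / f (x, y')) \<le> (D (0, 0) + \<epsilon>) * (y - y')\<^sup>2"
    proof (cases y y' rule: linorder_cases)
      case less
      have "(y - y') * (g (x, y) / f (x, y) - g (x, y') / f (x, y'))
         = (y' - y) * (g (x, y') / f (x, y') - g (x, y) / f (x, y))"
        by (simp only: left_diff_distrib right_diff_distrib)
      then show ?thesis using mvt[OF less b(2,4)] by (simp add: power2_commute)
    next
      case greater
      then show ?thesis using mvt b by blast
    qed simp
    then show "(y - y') * (g (x, y) / f (x, y) - g (x, y') / f (x, y')) \<le>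
        ((g2 (0, 0) * f (0, 0) - g (0, 0) * f2 (0, 0)) / (f (0, 0))\<^sup>2 + \<epsilon>) * (y - y')\<^sup>2"
      by (simp add: D_def)
  qed
qed

text \<open>Uniqueness concerns arbitrary trajectories of the original fields, which may leave the
  box; the bounds on the extended coefficients say nothing about them there.\<close>

lemma field_of_locally_lipschitz:
  assumes "C1_partials fm fm1 fm2" "C1_partials fp fp1 fp2" "C1_partials gm gm1 gm2" "C1_partials gp gp1 gp2"
  shows "\<exists>e>0. \<exists>L. \<forall>q\<in>ball p e. \<forall>q'\<in>ball p e.
      norm (field_of fm fp gm gp k q - field_of fm fp gm gp k q') \<le> L * norm (q - q')"
proof -
  have *: "\<exists>L. \<forall>q\<in>ball p 1. \<forall>q'\<in>ball p 1. norm ((f q, g q) - (f q', g q')) \<le> L * norm (q - q')"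
    if f: "C1_partials f f1 f2" and g: "C1_partials g g1 g2" for f f1 f2 g g1 g2
  proof -
    obtain Bf where Bf:
      "\<And>q q'. q \<in> cball p 1 \<Longrightarrow> q' \<in> cball p 1 \<Longrightarrow> \<bar>f q - f q'\<bar> \<le> Bf * norm (q - q')"
      using C1_partials_lipschitz[OF f] by blast
    obtain Bg where Bg:
      "\<And>q q'. q \<in> cball p 1 \<Longrightarrow> q' \<in> cball p 1 \<Longrightarrow> \<bar>g q - g q'\<bar> \<le> Bg * norm (q - q')"
      using C1_partials_lipschitz[OF g] by blast
    have "norm ((f q, g q) - (f q', g q')) \<le> (Bf + Bg) * norm (q - q')"
      if "q \<in> ball p 1" "q' \<in> ball p 1" for q q'
    proof -
      have "norm ((f q, g q) - (f q', g q')) \<le> \<bar>f q - f q'\<bar> + \<bar>g q - g q'\<bar>"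
        by (simp add: norm_Pair sqrt_sum_squares_le_sum_abs)
      also have "\<dots> \<le> Bf * norm (q - q') + Bg * norm (q - q')"
        using that by (intro add_mono Bf Bg) auto
      finally show ?thesis by (simp add: distrib_right)
    qed
    then show ?thesis by blast
  qed
  have "\<exists>L. \<forall>q\<in>ball p 1. \<forall>q'\<in>ball p 1.
      norm (field_of fm fp gm gp k q - field_of fm fp gm gp k q') \<le> L * norm (q - q')"
    using *[OF assms(2,4)] *[OF assms(1,3)] by (cases "k = 1") (simp_all add: field_of_def)
  then show ?thesis by (intro exI[of _ 1]) simp
qed

section \<open>Extension from the box and conclusion\<close>

definition clamp1 :: "real \<Rightarrow> real \<Rightarrow> real" where
  "clamp1 r x = max (- r) (min r x)"

text \<open>A nonexpansive retraction: composing with it in both coordinates preserves bounds and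
  Lipschitz constants and changes nothing on the box.\<close>

lemma clamp1:
  assumes "r > 0"
  shows "\<bar>clamp1 r x\<bar> \<le> r" "\<bar>clamp1 r x - clamp1 r y\<bar> \<le> \<bar>x - y\<bar>" "\<bar>x\<bar> \<le> r \<Longrightarrow> clamp1 r x = x"
  using assms by (auto simp: clamp1_def)

theorem theorem3p1:
  fixes fm fp gm gp :: "real \<times> real \<Rightarrow> real"
  assumes "class_C 4 fm" and "class_C 4 fp" and "class_C 4 gm" and "class_C 4 gp"
    and "fm (0, 0) > 0" and "fp (0, 0) < 0"
    and "fp (0, 0) * gm (0, 0) - fm (0, 0) * gp (0, 0) = 0"
    and "partial_y fp (0, 0) * gm (0, 0) + fp (0, 0) * partial_y gm (0, 0)
         - partial_y fm (0, 0) * gp (0, 0) - fm (0, 0) * partial_y gp (0, 0) > 0"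
  shows "\<exists>(z :: real \<Rightarrow> real \<Rightarrow> state) (T :: real \<Rightarrow> real).
    (\<exists>x0>0. \<forall>xb\<in>{0<..<x0}.
       limit_cycle (field_of fm fp gm gp) xb (z xb)
       \<and> orbitally_stable (field_of fm fp gm gp) xb (orbit (z xb))
       \<and> minimal_period (z xb) (T xb))
    \<and> ((\<lambda>xb. max_dist_origin (z xb)) \<longlongrightarrow> 0) (at_right 0)
    \<and> (\<lambda>xb. T xb - (- 2 / fp (0, 0) + 2 / fm (0, 0)) * xb) \<in> O[at_right 0](\<lambda>xb. xb ^ 2)"
proof -
  obtain fm1 fm2 where Pfm: "C1_partials fm fm1 fm2" using class_C_partials[OF assms(1)] .
  obtain fp1 fp2 where Pfp: "C1_partials fp fp1 fp2" using class_C_partials[OF assms(2)] .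
  obtain gm1 gm2 where Pgm: "C1_partials gm gm1 gm2" using class_C_partials[OF assms(3)] .
  obtain gp1 gp2 where Pgp: "C1_partials gp gp1 gp2" using class_C_partials[OF assms(4)] .
  note partial_y_eq[OF Pfm] partial_y_eq[OF Pfp] partial_y_eq[OF Pgm] partial_y_eq[OF Pgp]
  with assms(8) have third: "fp2 (0, 0) * gm (0, 0) + fp (0, 0) * gm2 (0, 0)
      - fm2 (0, 0) * gp (0, 0) - fm (0, 0) * gp2 (0, 0) > 0" by simp
  \<comment> \<open>\<open>ap\<close> and \<open>am\<close> are the \<open>y\<close>-derivatives at
    the origin of the slopes \<open>gp / - fp\<close> and \<open>gm / fm\<close>.\<close>
  define ap where "ap = (gp2 (0, 0) * - fp (0, 0) - gp (0, 0) * - fp2 (0, 0)) / (- fp (0, 0))\<^sup>2"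
  define am where "am = (gm2 (0, 0) * fm (0, 0) - gm (0, 0) * fm2 (0, 0)) / (fm (0, 0))\<^sup>2"
  have sum: "ap + am < 0"
  proof -
    \<comment> \<open>The direction common to both fields at the origin, by the second
      hypothesis.\<close>
    define \<mu> where "\<mu> = gm (0, 0) / fm (0, 0)"
    have gm: "gm (0, 0) = \<mu> * fm (0, 0)" and gp: "gp (0, 0) = \<mu> * fp (0, 0)"
      using assms(5,7) by (auto simp: \<mu>_def field_simps)
    have ap: "ap = (\<mu> * fp2 (0, 0) - gp2 (0, 0)) / fp (0, 0)"
      using assms(6) unfolding ap_def gp by (simp add: field_simps power2_eq_square)
    have am: "am = (gm2 (0, 0) - \<mu> * fm2 (0, 0)) / fm (0, 0)"
      using assms(5) unfolding am_def gm by (simp add: field_simps power2_eq_square)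
    have "(ap + am) * (fp (0, 0) * fm (0, 0)) = fp2 (0, 0) * gm (0, 0) + fp (0, 0) * gm2 (0, 0)
      - fm2 (0, 0) * gp (0, 0) - fm (0, 0) * gp2 (0, 0)"
      using assms(5,6) unfolding ap am gm gp by (simp add: field_simps)
    then have "0 < (ap + am) * (fp (0, 0) * fm (0, 0))" using third by simp
    moreover have "fp (0, 0) * fm (0, 0) < 0" using assms(5,6) by (simp add: mult_neg_pos)
    ultimately show ?thesis by (metis mult_nonneg_nonpos not_le less_imp_le)
  qed
  \<comment> \<open>Each constant \<open>\<alpha> k\<close> exceeds its derivative by
    \<open>\<epsilon>\<close>; with a quarter, the sum of the two is still
    \<open>(ap + am) / 2\<close>, hence negative.\<close>
  define \<epsilon> where "\<epsilon> = - (ap + am) / 4"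
  then have e4: "4 * \<epsilon> = - (ap + am)" by simp
  then have e: "\<epsilon> > 0" using sum by simp
  have fp0: "- fp (0, 0) > 0" using assms(6) by simp
  obtain Rp Lp Mp mp mp' where Rp: "0 < Rp" "0 < mp" "0 \<le> Lp"
    and p: "slope_bounded (\<lambda>z. - fp z) gp (ap + \<epsilon>) Rp Lp Mp mp mp'"
    using slope_bounds[OF C1_partials_minus[OF Pfp] Pgp fp0 e, folded ap_def] by blast
  obtain Rm Lm Mm mm mm' where Rm: "0 < Rm" "0 < mm" "0 \<le> Lm"
    and m: "slope_bounded fm gm (am + \<epsilon>) Rm Lm Mm mm mm'"
    using slope_bounds[OF Pfm Pgm assms(5) e, folded am_def] by blast
  define r where "r = min Rp Rm"
  have r: "r > 0" "r \<le> Rp" "r \<le> Rm" using Rp Rm by (auto simp: r_def)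
  define L where "L = max Lp Lm"
  define cl where "cl = clamp1 r"
  have cl: "\<bar>cl x\<bar> \<le> Rp" "\<bar>cl x\<bar> \<le> Rm" "\<bar>cl x - cl y\<bar> \<le> \<bar>x - y\<bar>" "\<bar>x\<bar> \<le> r \<Longrightarrow> cl x = x" for x y
    using clamp1[OF r(1)] r unfolding cl_def by (auto intro: order_trans)
  have clL: "A * (\<bar>cl x - cl x'\<bar> + \<bar>cl y - cl y'\<bar>) \<le> L * (\<bar>x - x'\<bar> + \<bar>y - y'\<bar>)"
    if "A = Lp \<or> A = Lm" for A x x' y y'
    using that Rp(3) Rm(3) by (intro mult_mono add_mono cl) (auto simp: L_def)
  define \<phi> where "\<phi> k x y = (if k = 1 then - fp (cl x, cl y) else fm (cl x, cl y))" for k :: int and x y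
  define h where "h k x y = (if k = 1 then gp (cl x, cl y) / - fp (cl x, cl y)
    else gm (cl x, cl y) / fm (cl x, cl y))" for k :: int and x y
  define \<alpha> where "\<alpha> k = (if k = 1 then ap + \<epsilon> else am + \<epsilon>)" for k :: int
  interpret hysteresis "field_of fm fp gm gp" h \<phi> \<alpha> r L "max Mp Mm" "min mp mm" "max mp' mm'"
  proof
    fix k :: int and x y x' y' :: real
    note P = slope_boundedD[OF p cl(1)[of x] cl(1)[of y] cl(1)[of x'] cl(1)[of y']]
      and M = slope_boundedD[OF m cl(2)[of x] cl(2)[of y] cl(2)[of x'] cl(2)[of y']]
    note if_simps = if_True if_False simp_thms
    show "\<bar>h k x y - h k x' y'\<bar> \<le> L * (\<bar>x - x'\<bar> + \<bar>y - y'\<bar>)"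
      using order_trans[OF P(5) clL] order_trans[OF M(5) clL] unfolding h_def
      by (cases "k = 1") (simp_all only: if_simps)
    show "\<bar>\<phi> k x y - \<phi> k x' y'\<bar> \<le> L * (\<bar>x - x'\<bar> + \<bar>y - y'\<bar>)"
      using order_trans[OF P(4) clL] order_trans[OF M(4) clL] unfolding \<phi>_def
      by (cases "k = 1") (simp_all only: if_simps)
    show "\<bar>h k x y\<bar> \<le> max Mp Mm"
      using max.coboundedI1[OF P(3), of Mm] max.coboundedI2[OF M(3), of Mp] unfolding h_def
      by (cases "k = 1") (simp_all only: if_simps)
    show "min mp mm \<le> \<phi> k x y" "\<phi> k x y \<le> max mp' mm'"
      using P(1) P(2) M(1) M(2) unfolding \<phi>_def by (auto simp: min_le_iff_disj le_max_iff_disj)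
    show "\<exists>e>0. \<exists>L. \<forall>q\<in>ball z e. \<forall>q'\<in>ball z e.
      norm (field_of fm fp gm gp k q - field_of fm fp gm gp k q') \<le> L * norm (q - q')" for z
      by (rule field_of_locally_lipschitz[OF Pfm Pfp Pgm Pgp])
    assume k: "k \<in> {-1, 1}" and x: "\<bar>x\<bar> \<le> r" and y: "\<bar>y\<bar> \<le> r"
    have nz: "fp (x, y) \<noteq> 0" "fm (x, y) \<noteq> 0" using P(1) M(1) Rp Rm by (auto simp: cl(4)[OF x] cl(4)[OF y])
    show "field_of fm fp gm gp k (x, y) = (- of_int k * \<phi> k x y, h k x y * \<phi> k x y)"
      using k nz by (auto simp: field_of_def \<phi>_def h_def cl(4)[OF x] cl(4)[OF y])
    assume y': "\<bar>y'\<bar> \<le> r"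
    show "(y - y') * (h k x y - h k x y') \<le> \<alpha> k * (y - y')\<^sup>2"
      using P(6) M(6) unfolding h_def \<alpha>_def cl(4)[OF x] cl(4)[OF y] cl(4)[OF y']
      by (cases "k = 1") (simp_all only: if_simps)
  next
    show "\<alpha> 1 + \<alpha> (-1) < 0" using sum e4 by (simp add: \<alpha>_def)
    \<comment> \<open>This is the second hypothesis, divided by the product of the two
      speeds.\<close>
    show "h 1 0 0 + h (-1) 0 0 = 0"
      using assms(5-7) r cl(4)[of 0] by (simp add: h_def field_simps)
  qed (use r Rp Rm in auto)
  have \<phi>0: "\<phi> 1 0 0 = - fp (0, 0)" "\<phi> (-1) 0 0 = fm (0, 0)"
    using r cl(4)[of 0] by (simp_all add: \<phi>_def)
  obtain x0 C where x0: "x0 > 0" and "\<forall>xb\<in>{0<..<x0}. \<exists>z T.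
    limit_cycle (field_of fm fp gm gp) xb z \<and> orbitally_stable (field_of fm fp gm gp) xb (orbit z)
    \<and> minimal_period z T \<and> \<bar>T - (2 / \<phi> 1 0 0 + 2 / \<phi> (-1) 0 0) * xb\<bar> \<le> C * xb\<^sup>2
    \<and> 0 \<le> max_dist_origin z \<and> max_dist_origin z \<le> C * xb"
    using small_cycles by blast
  \<comment> \<open>One choice for each \<open>xb\<close>; values outside the interval are
    arbitrary, and the limits from the right at \<open>0\<close> do not see them.\<close>
  then obtain z T where zT: "\<And>xb. xb \<in> {0<..<x0} \<Longrightarrow>
    limit_cycle (field_of fm fp gm gp) xb (z xb) \<and> orbitally_stable (field_of fm fp gm gp) xb (orbit (z xb))
    \<and> minimal_period (z xb) (T xb) \<and> \<bar>T xb - (2 / \<phi> 1 0 0 + 2 / \<phi> (-1) 0 0) * xb\<bar> \<le> C * xb\<^sup>2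
    \<and> 0 \<le> max_dist_origin (z xb) \<and> max_dist_origin (z xb) \<le> C * xb"
    by metis
  have ev: "\<forall>\<^sub>F xb in at_right 0. xb \<in> {0<..<x0}"
    using x0 eventually_at_right_real[of 0 x0] by simp
  have "((\<lambda>xb. max_dist_origin (z xb)) \<longlongrightarrow> 0) (at_right 0)"
  proof (rule tendsto_sandwich)
    show "\<forall>\<^sub>F xb in at_right 0. 0 \<le> max_dist_origin (z xb)"
      "\<forall>\<^sub>F xb in at_right 0. max_dist_origin (z xb) \<le> C * xb"
      using ev zT by (auto elim!: eventually_mono)
    have "((\<lambda>xb. C * xb) \<longlongrightarrow> C * 0) (at_right 0)" by (intro tendsto_intros)
    then show "((\<lambda>xb. C * xb) \<longlongrightarrow> 0) (at_right 0)" by simp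
  qed simp
  moreover have "(\<lambda>xb. T xb - (- 2 / fp (0, 0) + 2 / fm (0, 0)) * xb) \<in> O[at_right 0](\<lambda>xb. xb ^ 2)"
  proof (rule bigoI)
    show "\<forall>\<^sub>F xb in at_right 0. norm (T xb - (- 2 / fp (0, 0) + 2 / fm (0, 0)) * xb) \<le> C * norm (xb ^ 2)"
      using ev
    proof eventually_elim
      case (elim xb)
      then show ?case using zT[OF elim] by (simp add: \<phi>0)
    qed
  qed
  ultimately show ?thesis using zT x0 by blast
qed

end
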